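(* Let $n \ge 1$ and $w \in S_n$. The Schubert polynomial $\mathfrak{S}_w$ is a single standard elementary monomial, i.e. $\mathfrak{S}_w = e_{\vec a}$ for some sequence $\vec a$, if and only if $w$ avoids the patterns $312$ and $1432$.
   Context: For $i \ge 1$ and $j \ge 0$, $e^i_j$ denotes the elementary symmetric polynomial of degree $j$ in the variables $x_1,\dots,x_i$ (so $e^i_0 = 1$). A standard elementary monomial (SEM) is a product $e_{\vec a} = e^1_{a_1} e^2_{a_2} e^3_{a_3}\cdots$ where $\vec a = (a_1,a_2,\dots)$ is a sequence of nonnegative integers, only finitely many nonzero. Schubert polynomials $\mathfrak{S}_w$, $w \in S_n$, are defined by $\mathfrak{S}_{w_0} = x_1^{n-1}x_2^{n-2}\cdots x_{n-1}$ for the longest element $w_0$, and $\partial_i \mathfrak{S}_w = \mathfrak{S}_{ws_i}$ if $\ell(ws_i) = \ell(w)-1$, $\partial_i\mathfrak{S}_w = 0$ otherwise, where $\partial_i f = (f - s_i f)/(x_i - x_{i+1})$ and $s_i$ swaps $x_i, x_{i+1}$. A permutation $w$ contains a pattern $p \in S_k$ if there are indices $i_1 < \dots < i_k$ such that $w(i_1),\dots,w(i_k)$ are in the same relative order as $p(1),\dots,p(k)$; otherwise $w$ avoids $p$. *)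

theory Defs
  imports Main "HOL-Library.Poly_Mapping" "HOL-Combinatorics.Permutations"
    "HOL-Combinatorics.Transposition"
begin

(* Polynomials in the variables x_1, x_2, ... with integer coefficients:
  finitely supported maps from monomials (exponent vectors, nat =>0 nat) to int. *)
type_synonym mpoly = "(nat \<Rightarrow>\<^sub>0 nat) \<Rightarrow>\<^sub>0 int"

definition X :: "nat \<Rightarrow> mpoly" where
  "X k = Poly_Mapping.single (Poly_Mapping.single k 1) 1"

definition swap_var :: "nat \<Rightarrow> mpoly \<Rightarrow> mpoly" where
  "swap_var i f = (\<Sum>m\<in>Poly_Mapping.keys f.
      Poly_Mapping.single (Poly_Mapping.map_key (transpose i (Suc i)) m) (Poly_Mapping.lookup f m))"

definition ddiff :: "nat \<Rightarrow> mpoly \<Rightarrow> mpoly" where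
  "ddiff i f = (THE g. (X i - X (Suc i)) * g = f - swap_var i f)"

definition esym :: "nat \<Rightarrow> nat \<Rightarrow> mpoly" where
  "esym i j = (\<Sum>S\<in>{S. S \<subseteq> {1..i} \<and> card S = j}. \<Prod>k\<in>S. X k)"

(* Standard elementary monomial e_a = e^1_(a 1) e^2_(a 2) ... for finitely supported a
  (indexed from 1; a 0 is ignored). *)
definition sem :: "(nat \<Rightarrow> nat) \<Rightarrow> mpoly" where
  "sem a = (\<Prod>i\<in>{i. 1 \<le> i \<and> a i \<noteq> 0}. esym i (a i))"

definition is_sem :: "mpoly \<Rightarrow> bool" where
  "is_sem f \<longleftrightarrow> (\<exists>a. finite {i. a i \<noteq> 0} \<and> f = sem a)"

definition inv_len :: "nat \<Rightarrow> (nat \<Rightarrow> nat) \<Rightarrow> nat" where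
  "inv_len n w = card {(i, j). 1 \<le> i \<and> i < j \<and> j \<le> n \<and> w i > w j}"

definition w0 :: "nat \<Rightarrow> nat \<Rightarrow> nat" where
  "w0 n i = (if 1 \<le> i \<and> i \<le> n then n + 1 - i else i)"

definition schubert_family :: "nat \<Rightarrow> ((nat \<Rightarrow> nat) \<Rightarrow> mpoly) \<Rightarrow> bool" where
  "schubert_family n F \<longleftrightarrow>
     F (w0 n) = (\<Prod>k\<in>{1..<n}. X k ^ (n - k)) \<and>
     (\<forall>w i. w permutes {1..n} \<longrightarrow> 1 \<le> i \<longrightarrow> i < n \<longrightarrow>
        ddiff i (F w) =
          (if inv_len n (w \<circ> transpose i (Suc i)) + 1 = inv_len n w
           then F (w \<circ> transpose i (Suc i)) else 0))"

definition contains_pattern :: "nat \<Rightarrow> (nat \<Rightarrow> nat) \<Rightarrow> nat list \<Rightarrow> bool" where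
  "contains_pattern n w p \<longleftrightarrow>
     (\<exists>idx. length idx = length p \<and> sorted_wrt (<) idx \<and> set idx \<subseteq> {1..n} \<and>
        (\<forall>a < length p. \<forall>b < length p. w (idx ! a) < w (idx ! b) \<longleftrightarrow> p ! a < p ! b))"

definition avoids :: "nat \<Rightarrow> (nat \<Rightarrow> nat) \<Rightarrow> nat list \<Rightarrow> bool" where
  "avoids n w p \<longleftrightarrow> \<not> contains_pattern n w p"

end

theory Submission
  imports Defs
begin

text \<open>A divided difference acts on a product of elementary symmetric polynomials through the single
  factor \<open>e\<^sup>i\<^sub>j\<close> that is not symmetric in \<open>x\<^sub>i, x\<^sub>i\<^sub>+\<^sub>1\<close>, turning it into \<open>e\<^sup>i\<^sup>-\<^sup>1\<^sub>j\<^sub>-\<^sub>1\<close>; moreover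
  \<open>S(w\<^sub>0)\<close> is the product of all \<open>e\<^sup>i\<^sub>i\<close> with \<open>i < n\<close>.

  A permutation \<open>w\<close> of \<open>{1..n}\<close> avoiding 312 and 1432 with last value \<open>p + 1\<close> either has \<open>p = 0\<close> or
  is the direct sum of a permutation of \<open>{1..p}\<close> and a cycle \<open>2 3 \<dots> m 1\<close>. Removing the last value
  or the cycle divides the Schubert polynomial by \<open>e\<^sup>n\<^sup>-\<^sup>1\<^sub>n\<^sub>-\<^sub>1\<^sub>-\<^sub>p\<close>. The exponent sequences obtained in
  this way are those for which \<open>0 < a\<^sub>i < i\<close> implies \<open>a\<^sub>j = 0\<close> whenever \<open>i - a\<^sub>i \<le> j < i\<close>.

  Conversely, if \<open>S(w) = e\<^sub>a\<close> and \<open>a\<close> violates this condition at \<open>j < i\<close>, then two different words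
  of divided differences lead to the same nonzero polynomial. This is impossible, since each nonzero
  divided difference of a Schubert polynomial is a Schubert polynomial and \<open>w \<mapsto> S(w)\<close> is
  injective. So \<open>a\<close> satisfies the condition, and by injectivity \<open>w\<close> is the avoiding permutation
  constructed from \<open>a\<close>.\<close>

section \<open>Divided differences of polynomials\<close>

lemma X_neq: "i \<noteq> j \<Longrightarrow> X i \<noteq> X j"
proof
  assume ij: "i \<noteq> j" and eq: "X i = X j"
  have "Poly_Mapping.lookup (X i) (Poly_Mapping.single i 1) = (1::int)"
    by (simp add: X_def)
  moreover have "Poly_Mapping.single j (1::nat) \<noteq> Poly_Mapping.single i 1"
    using ij by (metis lookup_single_eq lookup_single_not_eq zero_neq_one)
  then have "Poly_Mapping.lookup (X j) (Poly_Mapping.single i 1) = (0::int)"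
    by (simp add: X_def lookup_single_not_eq)
  ultimately show False using eq by simp
qed

lemma poly_mapping_eq_sum_single:
  "f = (\<Sum>m\<in>Poly_Mapping.keys f. Poly_Mapping.single m (Poly_Mapping.lookup f m))"
proof (rule poly_mapping_eqI)
  fix k
  show "Poly_Mapping.lookup f k =
      Poly_Mapping.lookup (\<Sum>m\<in>Poly_Mapping.keys f. Poly_Mapping.single m (Poly_Mapping.lookup f m)) k"
  proof (cases "k \<in> Poly_Mapping.keys f")
    case True
    then show ?thesis
      by (simp add: lookup_sum lookup_single when_def sum.delta)
  next
    case False
    then show ?thesis
      by (simp add: lookup_sum lookup_single when_def sum.delta in_keys_iff)
  qed
qed

lemma mpoly_induct [case_names zero add]:
  fixes f :: mpoly
  assumes "P 0" and "\<And>m c f. P f \<Longrightarrow> P (Poly_Mapping.single m c + f)"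
  shows "P f"
proof -
  have "P (\<Sum>m\<in>A. Poly_Mapping.single m (Poly_Mapping.lookup f m))" if "finite A" for A
    using that by induction (simp_all add: assms)
  from this[of "Poly_Mapping.keys f"] show ?thesis
    using poly_mapping_eq_sum_single[of f] by simp
qed

section \<open>The variable swap as a ring endomorphism\<close>

abbreviation swap_mon :: "nat \<Rightarrow> (nat \<Rightarrow>\<^sub>0 nat) \<Rightarrow> (nat \<Rightarrow>\<^sub>0 nat)" where
  "swap_mon i \<equiv> Poly_Mapping.map_key (transpose i (Suc i))"

lemma swap_mon_add: "swap_mon i (m + m') = swap_mon i m + swap_mon i m'"
  by (rule map_key_plus) (rule inj_transpose)

lemma swap_var_eq_sum:
  assumes "finite A" "Poly_Mapping.keys f \<subseteq> A"
  shows "swap_var i f = (\<Sum>m\<in>A. Poly_Mapping.single (swap_mon i m) (Poly_Mapping.lookup f m))"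
  unfolding swap_var_def using assms
  by (intro sum.mono_neutral_left) (auto simp: in_keys_iff)

lemma swap_var_add: "swap_var i (f + g) = swap_var i f + swap_var i g"
proof -
  let ?A = "Poly_Mapping.keys f \<union> Poly_Mapping.keys g"
  have "Poly_Mapping.keys (f + g) \<subseteq> ?A"
    by (rule Poly_Mapping.keys_add)
  then show ?thesis
    by (simp add: swap_var_eq_sum[where A = ?A] lookup_add single_add sum.distrib)
qed

lemma swap_var_single:
  "swap_var i (Poly_Mapping.single m c) = Poly_Mapping.single (swap_mon i m) c"
  by (subst swap_var_eq_sum[where A = "{m}"]) (auto simp: in_keys_iff lookup_single when_def)

lemma swap_var_zero [simp]: "swap_var i 0 = 0"
  by (simp add: swap_var_def)

lemma swap_var_mult: "swap_var i (f * g) = swap_var i f * swap_var i g"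
proof (induction f rule: mpoly_induct)
  case (add m c f)
  have "swap_var i (Poly_Mapping.single m c * g) = Poly_Mapping.single (swap_mon i m) c * swap_var i g"
  proof (induction g rule: mpoly_induct)
    case (add m' c' g)
    then show ?case
      by (simp add: distrib_left swap_var_add swap_var_single mult_single swap_mon_add)
  qed simp
  with add show ?case
    by (simp add: distrib_right swap_var_add swap_var_single)
qed simp

lemma swap_var_one [simp]: "swap_var i 1 = 1"
  by (simp add: swap_var_single map_key_zero flip: single_one)

lemma swap_var_uminus: "swap_var i (- f) = - swap_var i f"
  using swap_var_add[of i f "- f"] by (simp add: eq_neg_iff_add_eq_0 add.commute)

lemma swap_var_diff: "swap_var i (f - g) = swap_var i f - swap_var i g"
  using swap_var_add[of i f "- g"] by (simp add: swap_var_uminus)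

lemma swap_var_sum: "swap_var i (sum f A) = (\<Sum>a\<in>A. swap_var i (f a))"
  by (induction A rule: infinite_finite_induct) (simp_all add: swap_var_add)

lemma swap_var_prod: "swap_var i (prod f A) = (\<Prod>a\<in>A. swap_var i (f a))"
  by (induction A rule: infinite_finite_induct) (simp_all add: swap_var_mult)

lemma swap_var_X: "swap_var i (X k) = X (transpose i (Suc i) k)"
proof -
  have "Poly_Mapping.single k (1::nat) =
      Poly_Mapping.single (transpose i (Suc i) (transpose i (Suc i) k)) 1"
    by (simp only: transpose_involutory)
  then have "swap_mon i (Poly_Mapping.single k 1) = Poly_Mapping.single (transpose i (Suc i) k) 1"
    by (metis inj_transpose map_key_single)
  then show ?thesis
    by (simp add: X_def swap_var_single)
qed

text \<open>A relational version of \<open>ddiff\<close>: divided differences are computed by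
  exhibiting the quotient, without arguing about the definite description each time.\<close>

definition is_ddiff :: "nat \<Rightarrow> mpoly \<Rightarrow> mpoly \<Rightarrow> bool" where
  "is_ddiff i f g \<longleftrightarrow> (X i - X (Suc i)) * g = f - swap_var i f"

text \<open>Polynomials form an integral domain, so the nonzero factor
  \<open>X i - X (Suc i)\<close> cancels.\<close>

lemma is_ddiff_unique: "is_ddiff i f g \<Longrightarrow> is_ddiff i f h \<Longrightarrow> g = h"
  using X_neq[of i "Suc i"] by (simp add: is_ddiff_def) (metis mult_left_cancel right_minus_eq)

lemma ddiff_eq: "is_ddiff i f g \<Longrightarrow> ddiff i f = g"
  unfolding ddiff_def
  by (rule the_equality) (auto simp: is_ddiff_def intro: is_ddiff_unique[unfolded is_ddiff_def])

lemma is_ddiff_add: "is_ddiff i f g \<Longrightarrow> is_ddiff i f' g' \<Longrightarrow> is_ddiff i (f + f') (g + g')"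
  unfolding is_ddiff_def swap_var_add by (simp only: distrib_left) simp

lemma is_ddiff_diff: "is_ddiff i f g \<Longrightarrow> is_ddiff i f' g' \<Longrightarrow> is_ddiff i (f - f') (g - g')"
  unfolding is_ddiff_def swap_var_diff by (simp only: right_diff_distrib) simp

text \<open>The twisted Leibniz rule for divided differences.\<close>

lemma is_ddiff_mult:
  assumes "is_ddiff i f g" "is_ddiff i f' g'"
  shows "is_ddiff i (f * f') (g * f' + swap_var i f * g')"
proof -
  have "(X i - X (Suc i)) * (g * f' + swap_var i f * g')
      = ((X i - X (Suc i)) * g) * f' + swap_var i f * ((X i - X (Suc i)) * g')"
    by (simp add: algebra_simps)
  also have "\<dots> = f * f' - swap_var i (f * f')"
    unfolding assms[unfolded is_ddiff_def] swap_var_mult by (simp add: algebra_simps)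
  finally show ?thesis by (simp add: is_ddiff_def)
qed

lemma is_ddiff_symmetric: "swap_var i f = f \<Longrightarrow> is_ddiff i f 0"
  by (simp add: is_ddiff_def)

lemma is_ddiff_mult_symmetric:
  assumes "is_ddiff i f g" "swap_var i h = h"
  shows "is_ddiff i (f * h) (g * h)"
  using is_ddiff_mult[OF assms(1) is_ddiff_symmetric[OF assms(2)]] by simp

lemma is_ddiff_symmetric_mult:
  assumes "is_ddiff i f g" "swap_var i h = h"
  shows "is_ddiff i (h * f) (h * g)"
  using is_ddiff_mult_symmetric[OF assms] by (simp add: mult.commute)

lemma is_ddiff_X: "\<exists>g. is_ddiff i (X k) g"
proof -
  consider "k = i" | "k = Suc i" | "k \<noteq> i" "k \<noteq> Suc i" by blast
  then show ?thesis
  proof cases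
    case 1
    then have "is_ddiff i (X k) 1" by (simp add: is_ddiff_def swap_var_X)
    then show ?thesis ..
  next
    case 2
    then have "is_ddiff i (X k) (-1)" by (simp add: is_ddiff_def swap_var_X)
    then show ?thesis ..
  next
    case 3
    then have "is_ddiff i (X k) 0" by (simp add: is_ddiff_def swap_var_X)
    then show ?thesis ..
  qed
qed

lemma is_ddiff_X_power: "\<exists>g. is_ddiff i (X k ^ e) g"
proof (induction e)
  case 0
  have "is_ddiff i 1 0" by (simp add: is_ddiff_symmetric)
  then show ?case by auto
next
  case (Suc e)
  then show ?case using is_ddiff_X[of i k] is_ddiff_mult by (metis power_Suc)
qed

lemma X_power: "X k ^ e = Poly_Mapping.single (Poly_Mapping.single k e) 1"
  by (induction e) (simp_all add: X_def mult_single flip: single_add)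

lemma single_eq_prod_X:
  "Poly_Mapping.single m c =
    Poly_Mapping.single 0 c * (\<Prod>k\<in>Poly_Mapping.keys m. X k ^ Poly_Mapping.lookup m k)"
proof -
  have "(\<Prod>k\<in>A. X k ^ Poly_Mapping.lookup m k) =
      Poly_Mapping.single (\<Sum>k\<in>A. Poly_Mapping.single k (Poly_Mapping.lookup m k)) 1" if "finite A" for A
    using that by induction (simp_all add: X_power mult_single)
  from this[OF finite_keys[of m]] show ?thesis
    by (simp add: mult_single flip: poly_mapping_eq_sum_single)
qed

text \<open>The quotient for a variable is 1, -1 or 0; the Leibniz rule extends existence to
  monomials, additivity to all polynomials. Hence \<open>ddiff\<close> always denotes a true
  quotient.\<close>

lemma is_ddiff_exists: "\<exists>g. is_ddiff i f g"
proof (induction f rule: mpoly_induct)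
  case zero
  have "is_ddiff i 0 0" by (simp add: is_ddiff_symmetric)
  then show ?case by blast
next
  case (add m c f)
  have "\<exists>g. is_ddiff i (\<Prod>k\<in>A. X k ^ Poly_Mapping.lookup m k) g" if "finite A" for A
    using that
  proof induction
    case empty
    have "is_ddiff i 1 0" by (simp add: is_ddiff_symmetric)
    then show ?case by auto
  next
    case (insert k A)
    obtain g h where "is_ddiff i (X k ^ Poly_Mapping.lookup m k) g"
      and "is_ddiff i (\<Prod>k\<in>A. X k ^ Poly_Mapping.lookup m k) h"
      using insert.IH is_ddiff_X_power by blast
    from is_ddiff_mult[OF this] show ?case
      unfolding prod.insert[OF insert.hyps] by (rule exI)
  qed
  then obtain h where
    "is_ddiff i (\<Prod>k\<in>Poly_Mapping.keys m. X k ^ Poly_Mapping.lookup m k) h"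
    using finite_keys by blast
  moreover have "swap_var i (Poly_Mapping.single 0 c) = Poly_Mapping.single 0 c"
    by (simp add: swap_var_single)
  ultimately have "is_ddiff i (Poly_Mapping.single m c) (Poly_Mapping.single 0 c * h)"
    unfolding single_eq_prod_X[of m c] by (rule is_ddiff_symmetric_mult)
  with add show ?case using is_ddiff_add by blast
qed

lemma is_ddiff_ddiff: "is_ddiff i f (ddiff i f)"
proof -
  obtain g where "is_ddiff i f g" using is_ddiff_exists by blast
  then show ?thesis by (simp add: ddiff_eq)
qed

section \<open>Elementary symmetric polynomials\<close>

lemma esym_0 [simp]: "esym i 0 = 1"
proof -
  have "{S. S \<subseteq> {1..i} \<and> card S = 0} = {{}}"
    by (auto simp: finite_subset[OF _ finite_atLeastAtMost])
  then show ?thesis by (simp add: esym_def)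
qed

lemma esym_eq_0: "i < j \<Longrightarrow> esym i j = 0"
proof -
  assume "i < j"
  then have "{S. S \<subseteq> {1..i} \<and> card S = j} = {}"
    by (auto dest: card_mono[OF finite_atLeastAtMost])
  then show ?thesis unfolding esym_def by (simp only: sum.empty)
qed

lemma esym_Suc: "esym (Suc i) (Suc j) = esym i (Suc j) + X (Suc i) * esym i j"
proof -
  let ?N = "{S. S \<subseteq> {1..i} \<and> card S = Suc j}" and ?Y = "{S. S \<subseteq> {1..i} \<and> card S = j}"
  have fin: "finite S" "Suc i \<notin> S" if "S \<subseteq> {1..i}" for S
    using that by (auto intro: finite_subset)
  have split: "{S. S \<subseteq> {1..Suc i} \<and> card S = Suc j} = ?N \<union> insert (Suc i) ` ?Y"
  proof (intro equalityI subsetI)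
    fix S assume S: "S \<in> {S. S \<subseteq> {1..Suc i} \<and> card S = Suc j}"
    show "S \<in> ?N \<union> insert (Suc i) ` ?Y"
    proof (cases "Suc i \<in> S")
      case True
      then have "S = insert (Suc i) (S - {Suc i})" "S - {Suc i} \<in> ?Y"
        using S by (auto simp: le_Suc_eq)
      then show ?thesis by blast
    qed (use S in \<open>auto simp: le_Suc_eq\<close>)
  next
    fix S assume "S \<in> ?N \<union> insert (Suc i) ` ?Y"
    then show "S \<in> {S. S \<subseteq> {1..Suc i} \<and> card S = Suc j}"
    proof
      assume "S \<in> insert (Suc i) ` ?Y"
      then obtain T where "S = insert (Suc i) T" "T \<subseteq> {1..i}" "card T = j" by blast
      with fin[of T] show ?thesis by auto
    qed auto
  qed
  have inj: "inj_on (insert (Suc i)) ?Y"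
    using fin(2) by (intro inj_onI) (metis (lifting) insert_ident mem_Collect_eq)
  have "esym (Suc i) (Suc j) = esym i (Suc j) + (\<Sum>S\<in>insert (Suc i) ` ?Y. \<Prod>k\<in>S. X k)"
    unfolding esym_def split
    by (rule sum.union_disjoint) (auto dest: fin)
  also have "(\<Sum>S\<in>insert (Suc i) ` ?Y. \<Prod>k\<in>S. X k) = (\<Sum>S\<in>?Y. X (Suc i) * (\<Prod>k\<in>S. X k))"
    unfolding sum.reindex[OF inj] using fin by (intro sum.cong) simp_all
  also have "\<dots> = X (Suc i) * esym i j"
    by (simp add: esym_def sum_distrib_left)
  finally show ?thesis .
qed

lemma esym_full: "esym i i = (\<Prod>k\<in>{1..i}. X k)"
proof -
  have "{S. S \<subseteq> {1..i} \<and> card S = i} = {{1..i}}"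
    using card_subset_eq[of "{1..i}"] by auto
  then show ?thesis by (simp add: esym_def)
qed

text \<open>The transposition maps \<open>{1..k}\<close> onto itself: both swapped indices lie
  inside if \<open>i < k\<close>, neither if \<open>i > k\<close>. So it permutes the subsets summed
  over.\<close>

lemma swap_var_esym: 
  assumes "1 \<le> i" "i \<noteq> k"
  shows "swap_var i (esym k j) = esym k j"
proof -
  let ?t = "transpose i (Suc i)" and ?A = "{S. S \<subseteq> {1..k} \<and> card S = j}"
  have t: "?t ` {1..k} = {1..k}"
  proof (cases "i < k")
    case True
    then have "?t permutes {1..k}" using assms by (intro permutes_swap_id) auto
    then show ?thesis by (rule permutes_image)
  next
    case False
    then have "?t x = x" if "x \<in> {1..k}" for x using that assms by (auto simp: transpose_def)
    then show ?thesis by simp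
  qed
  have img: "?t x \<in> {1..k}" if "x \<in> {1..k}" for x
    using that t by blast
  have tt: "?t ` ?t ` S = S" for S by (simp add: image_image)
  have "bij_betw (image ?t) ?A ?A"
    by (rule bij_betw_byWitness[where f' = "image ?t"])
       (use img in \<open>auto simp: tt card_image[OF inj_on_subset[OF inj_transpose]] image_subset_iff\<close>)
  moreover have "swap_var i (\<Prod>k\<in>S. X k) = (\<Prod>k\<in>?t ` S. X k)" for S
    by (simp add: swap_var_prod swap_var_X prod.reindex[OF inj_on_subset[OF inj_transpose]])
  ultimately show ?thesis
    unfolding esym_def swap_var_sum
    using sum.reindex_bij_betw[of "image ?t" ?A ?A "\<lambda>S. \<Prod>k\<in>S. X k"] by simp
qed

text \<open>In \<open>esym i j = esym (i - 1) j + X i * esym (i - 1) (j - 1)\<close> the swap only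
  turns \<open>X i\<close> into \<open>X (Suc i)\<close>.\<close>

lemma is_ddiff_esym:
  assumes "1 \<le> i" "1 \<le> j"
  shows "is_ddiff i (esym i j) (esym (i - 1) (j - 1))"
proof -
  obtain i' j' where ij: "i = Suc i'" "j = Suc j'" using assms by (metis Suc_le_D One_nat_def)
  have "swap_var i (esym i j) = esym i' j + X (Suc i) * esym i' j'"
    using assms by (simp add: ij esym_Suc swap_var_add swap_var_mult swap_var_esym swap_var_X)
  then show ?thesis
    by (simp add: is_ddiff_def ij esym_Suc algebra_simps)
qed

text \<open>Divided differences lower both indices until the degree is 0 and the polynomial is 1,
  which cannot arise from 0.\<close>

lemma esym_nonzero: "j \<le> i \<Longrightarrow> esym i j \<noteq> 0"
proof (induction j arbitrary: i)
  case (Suc j)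
  show ?case
  proof
    assume "esym i (Suc j) = 0"
    with is_ddiff_esym[of i "Suc j"] Suc.prems have "is_ddiff i 0 (esym (i - 1) j)" by simp
    then have "esym (i - 1) j = 0"
      by (rule is_ddiff_unique[OF _ is_ddiff_symmetric[OF swap_var_zero]])
    with Suc show False by simp
  qed
qed simp

text \<open>Written as a product of the \<open>e\<^sup>l\<^sub>l\<close>, the polynomial of the longest permutation is itself a
  standard elementary monomial.\<close>

definition stair :: "nat \<Rightarrow> mpoly" where
  "stair n = (\<Prod>l\<in>{1..<n}. esym l l)"

lemma stair_simps [simp]: "stair 0 = 1" "stair (Suc 0) = 1"
  by (simp_all add: stair_def)

lemma stair_Suc: "stair (Suc n) = stair n * esym n n"
proof (cases n)
  case 0
  then show ?thesis by simp
next
  case (Suc m)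
  then show ?thesis
    unfolding stair_def by (subst prod.atLeastLessThan_Suc) auto
qed

text \<open>The variable \<open>X k\<close> occurs once in each \<open>esym l l\<close> with
  \<open>k \<le> l < n\<close>, hence \<open>n - k\<close> times.\<close>

lemma stair_eq: "stair n = (\<Prod>k\<in>{1..<n}. X k ^ (n - k))"
proof (induction n)
  case (Suc n)
  have "(\<Prod>k\<in>{1..<Suc n}. X k ^ (Suc n - k)) = (\<Prod>k\<in>{1..<Suc n}. X k ^ (n - k) * X k)"
    by (rule prod.cong) (auto simp: Suc_diff_le)
  also have "\<dots> = (\<Prod>k\<in>{1..<Suc n}. X k ^ (n - k)) * (\<Prod>k\<in>{1..<Suc n}. X k)"
    by (rule prod.distrib)
  also have "(\<Prod>k\<in>{1..<Suc n}. X k ^ (n - k)) = (\<Prod>k\<in>{1..<n}. X k ^ (n - k))"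
    by (cases n) (auto simp: prod.atLeastLessThan_Suc)
  also have "(\<Prod>k\<in>{1..<Suc n}. X k) = esym n n"
    by (simp add: esym_full atLeastLessThanSuc_atLeastAtMost)
  finally show ?case by (simp add: stair_Suc Suc)
qed simp

lemma swap_var_prod_esym:
  "1 \<le> i \<Longrightarrow> i \<notin> A \<Longrightarrow> swap_var i (\<Prod>l\<in>A. esym l (a l)) = (\<Prod>l\<in>A. esym l (a l))"
  unfolding swap_var_prod by (rule prod.cong) (auto intro!: swap_var_esym)

lemma swap_var_stair: "1 \<le> i \<Longrightarrow> n \<le> i \<Longrightarrow> swap_var i (stair n) = stair n"
  unfolding stair_def by (rule swap_var_prod_esym) auto

lemma sem_eq_prod:
  assumes "\<And>i. n \<le> i \<Longrightarrow> a i = 0"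
  shows "sem a = (\<Prod>l\<in>{1..<n}. esym l (a l))"
  unfolding sem_def
proof (rule prod.mono_neutral_left)
  show "{i. 1 \<le> i \<and> a i \<noteq> 0} \<subseteq> {1..<n}"
  proof
    fix x assume "x \<in> {i. 1 \<le> i \<and> a i \<noteq> 0}"
    then show "x \<in> {1..<n}" using assms[of x] by (cases "n \<le> x") auto
  qed
qed auto

section \<open>Schubert families\<close>

text \<open>Transposing both entries of a pair matches the inversions of the two permutations,
  except for the pair \<open>(i, Suc i)\<close>, whose status is reversed.\<close>

lemma inv_len_transpose:
  assumes "1 \<le> i" "i < n" "w i \<noteq> w (Suc i)"
  shows "Suc (inv_len n (w \<circ> transpose i (Suc i))) = inv_len n w \<longleftrightarrow> w (Suc i) < w i"
    and "w (Suc i) < w i \<Longrightarrow> inv_len n (w \<circ> transpose i (Suc i)) < inv_len n w"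
proof -
  let ?t = "transpose i (Suc i)"
  define I where "I w = {(a, b). 1 \<le> a \<and> a < b \<and> b \<le> n \<and> w a > w b}" for w :: "nat \<Rightarrow> nat"
  have fin: "finite (I w)" for w
    by (rule finite_subset[of _ "{..n} \<times> {..n}"]) (auto simp: I_def)
  have maps: "map_prod ?t ?t x \<in> I (u \<circ> ?t) - {(i, Suc i)}" if "x \<in> I u - {(i, Suc i)}" for u x
    using that assms(1,2) by (auto simp: I_def transpose_def split: if_splits)
  have invol: "map_prod ?t ?t (map_prod ?t ?t x) = x" for x
    by (cases x) simp
  have "bij_betw (map_prod ?t ?t) (I w - {(i, Suc i)}) (I (w \<circ> ?t) - {(i, Suc i)})"
  proof (rule bij_betw_byWitness[where f' = "map_prod ?t ?t"])
    have "w \<circ> ?t \<circ> ?t = w" by (simp add: fun_eq_iff)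
    then show "map_prod ?t ?t ` (I (w \<circ> ?t) - {(i, Suc i)}) \<subseteq> I w - {(i, Suc i)}"
      using maps[of _ "w \<circ> ?t"] by (metis image_subsetI)
  qed (use maps[of _ w] in \<open>auto simp only: invol image_subset_iff\<close>)
  then have eq: "card (I w - {(i, Suc i)}) = card (I (w \<circ> ?t) - {(i, Suc i)})"
    by (rule bij_betw_same_card)
  have mem: "(i, Suc i) \<in> I u \<longleftrightarrow> u (Suc i) < u i" for u
    using assms(1,2) by (auto simp: I_def)
  have card: "card (I u) = card (I u - {(i, Suc i)}) + (if u (Suc i) < u i then 1 else 0)" for u
  proof (cases "(i, Suc i) \<in> I u")
    case True
    then show ?thesis using mem[of u] card.remove[OF fin[of u] True] by simp
  next
    case False
    then show ?thesis using mem[of u] by simp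
  qed
  have len: "inv_len n u = card (I u)" for u by (simp add: inv_len_def I_def)
  show "Suc (inv_len n (w \<circ> ?t)) = inv_len n w \<longleftrightarrow> w (Suc i) < w i"
    and "w (Suc i) < w i \<Longrightarrow> inv_len n (w \<circ> ?t) < inv_len n w"
    using card[of w] card[of "w \<circ> ?t"] eq assms(3) by (auto simp: len)
qed

section \<open>Descents of permutations\<close>

lemma permutes_transpose:
  assumes "w permutes {1..n}" "1 \<le> i" "i < n"
  shows "w \<circ> transpose i (Suc i) permutes {1..n}"
  by (rule permutes_compose[OF permutes_swap_id assms(1)]) (use assms in auto)

lemma permutes_neq: "w permutes A \<Longrightarrow> i \<noteq> j \<Longrightarrow> w i \<noteq> w j"
  by (metis permutes_inj injD)

lemma increasing_permutes_eq_id: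
  assumes "w permutes {1..n}" "\<And>i. 1 \<le> i \<Longrightarrow> i < n \<Longrightarrow> w i < w (Suc i)"
  shows "w = id"
proof
  fix k
  show "w k = id k"
  proof (cases "k \<in> {1..n}")
    case True
    have ge: "j \<le> w j" if "1 \<le> j" "j \<le> n" for j
      using that(1,2)
    proof (induction j rule: dec_induct)
      case base
      then show ?case using permutes_in_image[OF assms(1), of 1] by simp
    next
      case (step j)
      then show ?case using assms(2)[of j] by simp
    qed
    have le: "w j \<le> j" if "j \<le> n" "1 \<le> j" for j
      using that
    proof (induction j rule: inc_induct)
      case base
      then show ?case using permutes_in_image[OF assms(1), of n] by simp
    next
      case (step j)
      then show ?case using assms(2)[of j] by simp
    qed
    from ge[of k] le[of k] True show ?thesis by simp
  next
    case False
    then show ?thesis using permutes_not_in[OF assms(1)] by simp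
  qed
qed

text \<open>Undoing a descent lowers the number of inversions, and only the identity has no
  descent.\<close>

lemma permutes_descent_induct [consumes 1, case_names id descent]:
  assumes "w permutes {1..n}" and "P id"
    and "\<And>w i. \<lbrakk>w permutes {1..n}; 1 \<le> i; i < n; w (Suc i) < w i;
           P (w \<circ> transpose i (Suc i))\<rbrakk> \<Longrightarrow> P w"
  shows "P w"
  using assms(1)
proof (induction "inv_len n w" arbitrary: w rule: less_induct)
  case less
  show ?case
  proof (cases "\<exists>i. 1 \<le> i \<and> i < n \<and> w (Suc i) < w i")
    case True
    then obtain i where i: "1 \<le> i" "i < n" "w (Suc i) < w i" by blast
    have "P (w \<circ> transpose i (Suc i))"
      using i less.prems
      by (intro less.hyps[OF inv_len_transpose(2) permutes_transpose]) auto
    with less.prems i show ?thesis by (rule assms(3))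
  next
    case False
    then have "w = id"
    proof (intro increasing_permutes_eq_id[OF less.prems])
      fix i assume "1 \<le> i" "i < n"
      with False permutes_neq[OF less.prems, of i "Suc i"] show "w i < w (Suc i)" by force
    qed
    with assms(2) show ?thesis by simp
  qed
qed

text \<open>Unlike \<^const>\<open>schubert_family\<close>, the recursion below does not mention \<^term>\<open>n\<close> through the
  inversion count, which makes the restriction to smaller \<^term>\<open>n\<close> immediate up to the initial value.\<close>

definition descent_family :: "nat \<Rightarrow> ((nat \<Rightarrow> nat) \<Rightarrow> mpoly) \<Rightarrow> bool" where
  "descent_family n F \<longleftrightarrow> F (w0 n) = stair n \<and>
     (\<forall>w i. w permutes {1..n} \<longrightarrow> 1 \<le> i \<longrightarrow> i < n \<longrightarrow>
        is_ddiff i (F w) (if w (Suc i) < w i then F (w \<circ> transpose i (Suc i)) else 0))"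

lemma schubert_family_imp_descent_family:
  assumes "schubert_family n F"
  shows "descent_family n F"
  unfolding descent_family_def
proof (intro conjI allI impI)
  show "F (w0 n) = stair n" using assms by (simp add: schubert_family_def stair_eq)
  fix w :: "nat \<Rightarrow> nat" and i
  assume w: "w permutes {1..n}" and i: "1 \<le> i" "i < n"
  have "ddiff i (F w) = (if w (Suc i) < w i then F (w \<circ> transpose i (Suc i)) else 0)"
    using assms w i inv_len_transpose(1)[OF i, of w] permutes_neq[OF w, of i "Suc i"]
    by (simp add: schubert_family_def)
  then show "is_ddiff i (F w) (if w (Suc i) < w i then F (w \<circ> transpose i (Suc i)) else 0)"
    using is_ddiff_ddiff[of i "F w"] by simp
qed

lemma descent_family_descent:
  assumes "descent_family n F" "w permutes {1..n}" "1 \<le> i" "i < n" "w (Suc i) < w i"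
    and "is_ddiff i (F w) g"
  shows "F (w \<circ> transpose i (Suc i)) = g"
proof -
  have "is_ddiff i (F w) (if w (Suc i) < w i then F (w \<circ> transpose i (Suc i)) else 0)"
    using assms(1-4) by (simp only: descent_family_def)
  with assms(5,6) show ?thesis using is_ddiff_unique by simp
qed

lemma descent_family_nonzero:
  assumes "descent_family n F" "w permutes {1..n}" "1 \<le> i" "i < n"
    and "is_ddiff i (F w) g" "g \<noteq> 0"
  shows "w (Suc i) < w i" "F (w \<circ> transpose i (Suc i)) = g"
proof -
  have "is_ddiff i (F w) (if w (Suc i) < w i then F (w \<circ> transpose i (Suc i)) else 0)"
    using assms(1-4) by (simp only: descent_family_def)
  then have "g = (if w (Suc i) < w i then F (w \<circ> transpose i (Suc i)) else 0)"
    by (rule is_ddiff_unique[OF assms(5)])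
  with assms(6) show "w (Suc i) < w i" "F (w \<circ> transpose i (Suc i)) = g"
    by (simp_all split: if_splits)
qed

lemma w0_permutes: "w0 n permutes {1..n}"
  by (rule inj_imp_permutes) (auto simp: w0_def inj_on_def)

text \<open>The value \<open>n + 1\<close> of the longest permutation is moved from the first to the last position; all
  polynomials on the way are standard elementary monomials.\<close>

lemma descent_family_Suc:
  assumes fam: "descent_family (Suc n) F"
  shows "descent_family n F"
proof -
  \<comment> \<open>In one-line notation \<open>v k\<close> is
    \<open>n, ..., n + 1 - k, n + 1, n - k, ..., 1\<close>.\<close>
  define v where "v k l = (if 1 \<le> l \<and> l \<le> k then n + 1 - l else if l = Suc k then Suc n
    else if Suc k < l \<and> l \<le> Suc n then n + 2 - l else l)" for k l :: nat
  have v0: "v 0 = w0 (Suc n)" by (auto simp: fun_eq_iff v_def w0_def)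
  have vn: "v n = w0 n" by (auto simp: fun_eq_iff v_def w0_def)
  have v_Suc: "v k \<circ> transpose (Suc k) (Suc (Suc k)) = v (Suc k)" if "k < n" for k
    using that by (auto simp: fun_eq_iff v_def transpose_def)
  have "v k permutes {1..Suc n} \<and> F (v k) = stair k * (\<Prod>l\<in>{Suc k..<Suc n}. esym l l)" if "k \<le> n" for k
    using that
  proof (induction k)
    case 0
    then show ?case
      using fam w0_permutes[of "Suc n"] by (simp add: v0 descent_family_def) (simp add: stair_def)
  next
    case (Suc k)
    let ?R = "\<Prod>l\<in>{Suc (Suc k)..<Suc n}. esym l l"
    from Suc have v: "v k permutes {1..Suc n}"
      and F: "F (v k) = stair k * (\<Prod>l\<in>{Suc k..<Suc n}. esym l l)" by auto
    have "{Suc k..<Suc n} = insert (Suc k) {Suc (Suc k)..<Suc n}" using Suc.prems by auto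
    then have F': "F (v k) = stair k * (esym (Suc k) (Suc k) * ?R)" unfolding F by simp
    \<comment> \<open>Only the factor with both indices \<open>Suc k\<close> is affected. It drops
      to \<open>esym k k\<close>, which extends \<open>stair k\<close> to
      \<open>stair (Suc k)\<close>.\<close>
    have "is_ddiff (Suc k) (esym (Suc k) (Suc k)) (esym k k)"
      using is_ddiff_esym[of "Suc k" "Suc k"] by simp
    then have "is_ddiff (Suc k) (F (v k)) (stair k * (esym k k * ?R))"
      unfolding F'
      by (intro is_ddiff_symmetric_mult is_ddiff_mult_symmetric swap_var_stair swap_var_prod_esym) auto
    then have "F (v k \<circ> transpose (Suc k) (Suc (Suc k))) = stair k * (esym k k * ?R)"
      using Suc.prems v by (intro descent_family_descent[OF fam]) (auto simp: v_def)
    moreover have "v k \<circ> transpose (Suc k) (Suc (Suc k)) permutes {1..Suc n}"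
      using Suc.prems v by (intro permutes_transpose) auto
    ultimately show ?case using Suc.prems by (simp add: v_Suc stair_Suc mult.assoc)
  qed
  from this[of n] have "F (w0 n) = stair n" by (simp add: vn)
  moreover have "w permutes {1..Suc n}" if "w permutes {1..n}" for w
    using that by (rule permutes_subset) auto
  ultimately show ?thesis using fam by (simp add: descent_family_def)
qed

lemma descent_family_mono:
  assumes "descent_family n F" "m \<le> n"
  shows "descent_family m F"
  using assms(2,1) by (induction rule: inc_induct) (auto dest: descent_family_Suc)

lemma descent_family_w0: "descent_family n F \<Longrightarrow> m \<le> n \<Longrightarrow> F (w0 m) = stair m"
  using descent_family_mono[of n F m] by (simp add: descent_family_def)

lemma w0_0: "w0 0 = id"
  by (auto simp: w0_def fun_eq_iff)

lemma descent_family_id: "descent_family n F \<Longrightarrow> F id = 1"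
  using descent_family_w0[of n F 0] by (simp add: w0_0)

text \<open>Undoing descents leads to the identity, with polynomial 1, while 0 has only zero divided
  differences.\<close>

lemma descent_family_neq_0:
  assumes "descent_family n F" "w permutes {1..n}"
  shows "F w \<noteq> 0"
  using assms(2)
proof (induction rule: permutes_descent_induct)
  case id
  show ?case unfolding descent_family_id[OF assms(1)] by simp
next
  case (descent w i)
  show ?case
  proof
    assume "F w = 0"
    then have "is_ddiff i (F w) 0" by (simp add: is_ddiff_symmetric)
    then have "F (w \<circ> transpose i (Suc i)) = 0"
      by (rule descent_family_descent[OF assms(1) descent.hyps])
    with descent.IH show False by contradiction
  qed
qed

text \<open>The polynomial determines the descents, as its divided difference at \<open>i\<close> is
  nonzero exactly at a descent. Undoing the same descent in both permutations reduces to a shorter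
  \<open>w\<close>.\<close>

lemma descent_family_inj:
  assumes fam: "descent_family n F" and "w permutes {1..n}" "v permutes {1..n}" "F w = F v"
  shows "w = v"
  using assms(2-4)
proof (induction arbitrary: v rule: permutes_descent_induct)
  case id
  show ?case
  proof (rule sym, rule increasing_permutes_eq_id[OF id.prems(1)])
    fix i assume i: "1 \<le> i" "i < n"
    have "is_ddiff i (F v) 0"
      unfolding id.prems(2)[symmetric] descent_family_id[OF fam] by (simp add: is_ddiff_symmetric)
    with descent_family_descent[OF fam id.prems(1) i] descent_family_neq_0[OF fam]
      permutes_transpose[OF id.prems(1) i]
    have "\<not> v (Suc i) < v i" by metis
    with permutes_neq[OF id.prems(1), of i "Suc i"] show "v i < v (Suc i)" by simp
  qed
next
  case (descent w i)
  let ?t = "transpose i (Suc i)"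
  have F: "F (w \<circ> ?t) \<noteq> 0"
    using descent by (intro descent_family_neq_0[OF fam] permutes_transpose)
  have "is_ddiff i (F w) (F (w \<circ> ?t))"
    using is_ddiff_ddiff[of i "F w"] descent_family_descent[OF fam descent.hyps is_ddiff_ddiff] by simp
  then have dv: "is_ddiff i (F v) (F (w \<circ> ?t))" using descent by simp
  have "F (w \<circ> ?t) = F (v \<circ> ?t)"
    by (rule descent_family_nonzero(2)[OF fam descent.prems(1) descent.hyps(2,3) dv F, symmetric])
  then have "w \<circ> ?t = v \<circ> ?t"
    by (rule descent.IH[OF permutes_transpose[OF descent.prems(1) descent.hyps(2,3)]])
  then have "w \<circ> ?t \<circ> ?t = v \<circ> ?t \<circ> ?t" by simp
  then show ?case by (simp add: fun_eq_iff)
qed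

text \<open>As \<open>\<sigma>\<close> increases on \<open>{1..p}\<close>,
  \<open>\<sigma> \<circ> u\<close> and \<open>u\<close> have the same descents at positions below
  \<open>p\<close>, and \<open>S\<close> acts as a constant for the divided differences there. So a
  factorization known for the longest permutation passes down to every \<open>u\<close>.\<close>

lemma descent_family_product:
  assumes fam: "descent_family n F" and "p \<le> n"
    and \<sigma>: "\<sigma> permutes {1..n}" "\<And>a b. 1 \<le> a \<Longrightarrow> a < b \<Longrightarrow> b \<le> p \<Longrightarrow> \<sigma> a < \<sigma> b"
    and S: "\<And>i. 1 \<le> i \<Longrightarrow> i < p \<Longrightarrow> swap_var i S = S"
    and top: "F (\<sigma> \<circ> w0 p) = F (w0 p) * S"
    and u: "u permutes {1..p}"
  shows "F (\<sigma> \<circ> u) = F u * S"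
proof -
  have perm: "w permutes {1..p} \<Longrightarrow> w permutes {1..n}" for w
    by (erule permutes_subset) (use assms(2) in auto)
  \<comment> \<open>Composing with \<open>w0 p\<close> reverses the values: the induction starts at
    the longest permutation, and undoing a descent of \<open>w\<close> corresponds to creating one
    in \<open>w0 p \<circ> w\<close>.\<close>
  have "F (\<sigma> \<circ> (w0 p \<circ> w)) = F (w0 p \<circ> w) * S" if "w permutes {1..p}" for w
    using that
  proof (induction rule: permutes_descent_induct)
    case id
    then show ?case using top by (simp only: comp_id)
  next
    case (descent w i)
    let ?t = "transpose i (Suc i)"
    define v where "v = w0 p \<circ> w \<circ> ?t"
    have v: "v permutes {1..p}"
      unfolding v_def using descent
      by (intro permutes_transpose[OF permutes_compose[OF _ w0_permutes]])
    have vt: "v \<circ> ?t = w0 p \<circ> w" by (simp add: v_def fun_eq_iff)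
    have "w i \<in> {1..p}" "w (Suc i) \<in> {1..p}" "v i \<in> {1..p}" "v (Suc i) \<in> {1..p}"
      using descent.hyps v by (simp_all add: permutes_in_image del: atLeastAtMost_iff) auto
    then have desc: "v (Suc i) < v i" "\<sigma> (v (Suc i)) < \<sigma> (v i)"
      using descent.hyps(4) \<sigma>(2)[of "v (Suc i)" "v i"] by (auto simp: v_def w0_def)
    have i: "i < n" using descent assms(2) by simp
    have "is_ddiff i (F v) (F (v \<circ> ?t))"
      using is_ddiff_ddiff[of i "F v"]
        descent_family_descent[OF fam perm[OF v] descent.hyps(2) i desc(1) is_ddiff_ddiff] by simp
    then have "is_ddiff i (F (\<sigma> \<circ> v)) (F (v \<circ> ?t) * S)"
      unfolding v_def comp_assoc descent.IH[unfolded comp_assoc]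
      using descent.hyps S by (intro is_ddiff_mult_symmetric) (auto simp only: comp_assoc)
    then have "F (\<sigma> \<circ> v \<circ> ?t) = F (v \<circ> ?t) * S"
      using descent.hyps i desc v
      by (intro descent_family_descent[OF fam permutes_compose[OF perm \<sigma>(1)]]) auto
    then show ?case by (simp only: comp_assoc vt)
  qed
  from this[of "w0 p \<circ> u"] have "F (\<sigma> \<circ> (w0 p \<circ> (w0 p \<circ> u))) = F (w0 p \<circ> (w0 p \<circ> u)) * S"
    by (simp only: permutes_compose[OF u w0_permutes])
  moreover have "w0 p \<circ> (w0 p \<circ> u) = u" by (auto simp: fun_eq_iff w0_def)
  ultimately show ?thesis by simp
qed

section \<open>Appending a cycle as a direct summand\<close>

text \<open>For \<open>p < n\<close> this is \<open>1, ..., p, p + 2, ..., n, p + 1\<close> in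
  one-line notation; otherwise it is the identity.\<close>

definition rot :: "nat \<Rightarrow> nat \<Rightarrow> nat \<Rightarrow> nat" where
  "rot p n l = (if p < l \<and> l < n then Suc l else if p < n \<and> l = n then Suc p else l)"

lemma rot_permutes: "rot p n permutes {1..n}"
  by (rule inj_imp_permutes) (auto simp: rot_def inj_on_def split: if_splits)

lemma rot_comp_permutes:
  assumes "u permutes {1..m}" "m \<le> n"
  shows "rot p n \<circ> u permutes {1..n}"
  by (rule permutes_compose[OF permutes_subset[OF assms(1)] rot_permutes]) (use assms(2) in auto)

lemma rot_strict_mono: "a < b \<Longrightarrow> b < n \<Longrightarrow> rot p n a < rot p n b"
  by (auto simp: rot_def)

lemma rot_0_w0: "rot 0 (Suc n) \<circ> w0 n = w0 (Suc n)"
  by (auto simp: fun_eq_iff rot_def w0_def)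

text \<open>The composition raises the values of \<open>u\<close> by 1 and appends the value 1. The
  factor is found at \<open>u = w0 n\<close>, where it is the quotient of two staircase
  products.\<close>

lemma schubert_rot_0:
  assumes fam: "descent_family (Suc n) F" and "u permutes {1..n}"
  shows "F (rot 0 (Suc n) \<circ> u) = F u * esym n n"
proof (rule descent_family_product[OF fam _ rot_permutes _ _ _ assms(2)])
  show "F (rot 0 (Suc n) \<circ> w0 n) = F (w0 n) * esym n n"
    using descent_family_w0[OF fam, of n] descent_family_w0[OF fam, of "Suc n"]
    by (simp add: rot_0_w0 stair_Suc)
qed (auto intro: rot_strict_mono swap_var_esym)

text \<open>By induction the polynomial of \<open>rot 0 n \<circ> (rot p (n - 1) \<circ> w0 p)\<close>, a permutation ending in 1, is
  known. Moving this 1 to position \<open>p + 1\<close> produces \<open>rot (p + 1) n \<circ> w0 (p + 1)\<close>. The intermediate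
  polynomials are not standard elementary monomials, but differences \<open>Z j\<close> of two products on which
  the next divided difference acts factorwise; the second product vanishes in the last step.\<close>

lemma schubert_rot_w0:
  assumes "descent_family n F" "p < n"
  shows "F (rot p n \<circ> w0 p) = stair p * esym (n - 1) (n - 1 - p)"
  using assms
proof (induction p arbitrary: n)
  case 0
  then obtain m where n: "n = Suc m" by (cases n) auto
  have "id permutes {1..m}" by (rule permutes_id)
  from schubert_rot_0[OF _ this] 0 show ?case
    by (simp add: n w0_0 descent_family_id)
next
  case (Suc p)
  note fam = Suc.prems(1)
  show ?case
  proof (cases "n = Suc (Suc p)")
    case True
    have "rot (Suc p) n = id" by (auto simp: fun_eq_iff rot_def True)
    then show ?thesis using descent_family_w0[OF fam, of "Suc p"] by (simp add: True)
  next
    case False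
    define M where "M = n - 1"
    with False Suc.prems have n: "n = Suc M" and pM: "Suc p < M" by auto
    define r where "r = M - Suc p"
    \<comment> \<open>In one-line notation \<open>v\<close> is
      \<open>p + 1, ..., 2, p + 3, ..., n, p + 2, 1\<close>. In \<open>v \<circ> c j\<close> the
      final 1 is moved to position \<open>j + 1\<close>.\<close>
    define v where "v = rot 0 n \<circ> (rot p M \<circ> w0 p)"
    define c where "c j l = (if l = Suc j then n else if Suc j < l \<and> l \<le> n then l - 1 else l)"
      for j l :: nat
    \<comment> \<open>The factors of upper index \<open>M\<close> are symmetric in the first
      \<open>M\<close> variables. So for \<open>Suc p < j < M\<close> the divided difference at
      \<open>j\<close> only lowers the indices of the other factors, taking \<open>Z j\<close> to
      \<open>Z (j - 1)\<close>.\<close>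
    define Z where "Z j = esym j j * esym M r - esym M M * esym j (j - Suc p)" for j
    have v: "v permutes {1..n}"
      unfolding v_def using n pM
      by (intro rot_comp_permutes[of _ M, OF rot_comp_permutes[of _ p, OF w0_permutes]]) auto
    have vn: "v n = 1" using pM by (simp add: v_def n rot_def w0_def)
    have "F v = F (rot p M \<circ> w0 p) * esym M M"
      unfolding v_def n using pM fam
      by (intro schubert_rot_0 rot_comp_permutes[of _ p, OF w0_permutes]) (auto simp: n)
    also have "F (rot p M \<circ> w0 p) = stair p * esym (M - 1) r"
      using Suc.IH[of M] descent_family_Suc[of M F] fam pM unfolding n r_def by (simp del: o_apply)
    finally have Fv: "F v = stair p * (esym (M - 1) r * esym M M)" by (simp add: mult.assoc)
    have c_M: "c M = id" by (auto simp: c_def fun_eq_iff n)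
    have c_step: "v \<circ> c j \<circ> transpose j (Suc j) = v \<circ> c (j - 1)" if "1 \<le> j" "j \<le> M" for j
      using that by (auto simp: fun_eq_iff c_def n transpose_def)
    have desc: "(v \<circ> c j) (Suc j) < (v \<circ> c j) j" if "1 \<le> j" "j \<le> M" for j
    proof -
      have "v j \<noteq> v n" by (rule permutes_neq[OF v]) (use that in \<open>simp add: n\<close>)
      moreover have "v j \<in> {1..n}" using that permutes_in_image[OF v, of j] by (simp add: n)
      ultimately show ?thesis using that by (simp add: c_def vn)
    qed
    define reach where "reach j f \<longleftrightarrow> v \<circ> c j permutes {1..n} \<and> F (v \<circ> c j) = f" for j f
    have move: "reach (j - 1) g" if "reach j f" "is_ddiff j f g" "1 \<le> j" "j \<le> M" for j f g
    proof -
      have vj: "v \<circ> c j permutes {1..n}" "is_ddiff j (F (v \<circ> c j)) g" "j < n"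
        using that by (simp_all add: reach_def n)
      have "F (v \<circ> c j \<circ> transpose j (Suc j)) = g"
        using desc[OF that(3,4)] vj that(3) by (intro descent_family_descent[OF fam])
      with permutes_transpose[of "v \<circ> c j", OF vj(1) that(3) vj(3)] show ?thesis
        unfolding reach_def c_step[OF that(3,4)] by blast
    qed
    have e_full: "is_ddiff j (esym j j) (esym (j - 1) (j - 1))" if "1 \<le> j" for j
      using is_ddiff_esym that by simp
    have base: "reach M (stair p * (esym (M - 1) r * esym M M))"
      unfolding reach_def c_M using v Fv by (simp only: comp_id)
    have "is_ddiff M (stair p * (esym (M - 1) r * esym M M))
        (stair p * (esym (M - 1) r * esym (M - 1) (M - 1)))"
      using pM by (intro is_ddiff_symmetric_mult e_full swap_var_esym swap_var_stair) auto
    from move[OF base this] pM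
    have "reach (M - 1) (stair p * (esym (M - 1) r * esym (M - 1) (M - 1)))" by simp
    \<comment> \<open>On the left both factors of upper index \<open>M - 1\<close> would be hit by
      the next divided difference. Expanding \<open>esym M r\<close> and \<open>esym M M\<close> in
      \<open>X M\<close> gives a difference of products with one such factor each.\<close>
    moreover have "stair p * (esym (M - 1) r * esym (M - 1) (M - 1)) = stair p * Z (M - 1)"
    proof -
      obtain m s where m: "M = Suc m" "r = Suc s" "m - Suc p = s"
        using pM by (cases M; cases r) (auto simp: r_def)
      have "esym (Suc m) (Suc m) = X (Suc m) * esym m m"
        by (simp add: esym_Suc esym_eq_0)
      then show ?thesis unfolding Z_def by (simp add: m esym_Suc algebra_simps)
    qed
    ultimately have start: "reach (M - 1) (stair p * Z (M - 1))"
      by (simp only:)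
    have "reach (Suc p) (stair p * Z (Suc p))"
    proof -
      have "Suc p \<le> M - 1" using pM by simp
      then show ?thesis
      proof (induction rule: inc_induct)
        case base
        show ?case by (rule start)
      next
        case (step j)
        have "is_ddiff (Suc j) (Z (Suc j)) (esym j j * esym M r - esym M M * esym j (j - Suc p))"
          unfolding Z_def
          using step.hyps pM e_full[of "Suc j"] is_ddiff_esym[of "Suc j" "Suc j - Suc p"]
          by (intro is_ddiff_diff is_ddiff_symmetric_mult is_ddiff_mult_symmetric swap_var_esym)
             (auto simp: Suc_diff_le)
        then have "is_ddiff (Suc j) (stair p * Z (Suc j)) (stair p * Z j)"
          unfolding Z_def[of j, symmetric] using step.hyps
          by (intro is_ddiff_symmetric_mult swap_var_stair) auto
        from move[OF step.IH this] step.hyps show ?case by simp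
      qed
    qed
    \<comment> \<open>The second product is now \<open>esym M M * esym (Suc p) 0\<close>, which is
      symmetric; this accounts for the 0.\<close>
    moreover have "is_ddiff (Suc p) (Z (Suc p)) (esym p p * esym M r - 0)"
      unfolding Z_def using pM e_full[of "Suc p"]
      by (intro is_ddiff_diff is_ddiff_mult_symmetric swap_var_esym)
         (auto intro!: is_ddiff_symmetric swap_var_esym simp: swap_var_mult)
    then have "is_ddiff (Suc p) (stair p * Z (Suc p)) (stair (Suc p) * esym M r)"
      unfolding stair_Suc mult.assoc by (intro is_ddiff_symmetric_mult swap_var_stair) auto
    ultimately have "reach (Suc p - 1) (stair (Suc p) * esym M r)"
      by (rule move) (use pM in auto)
    then have "reach p (stair (Suc p) * esym M r)" by simp
    moreover have "v \<circ> c p = rot (Suc p) n \<circ> w0 (Suc p)"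
      using pM by (auto simp: fun_eq_iff v_def c_def rot_def w0_def n)
    ultimately show ?thesis unfolding reach_def by (simp only: n r_def) simp
  qed
qed

text \<open>The factor is symmetric in the first \<open>n - 1 \<ge> p\<close> variables, so the case
  of the longest permutation passes to all \<open>u\<close>.\<close>

lemma schubert_rot:
  assumes fam: "descent_family n F" and "p < n" and "u permutes {1..p}"
  shows "F (rot p n \<circ> u) = F u * esym (n - 1) (n - 1 - p)"
proof (rule descent_family_product[OF fam _ rot_permutes _ _ _ assms(3)])
  show "F (rot p n \<circ> w0 p) = F (w0 p) * esym (n - 1) (n - 1 - p)"
    using schubert_rot_w0[OF fam assms(2)] descent_family_w0[OF fam, of p] assms(2) by simp
qed (use assms(2) in \<open>auto intro: rot_strict_mono swap_var_esym\<close>)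

section \<open>Permutations avoiding 312 and 1432\<close>

lemma contains_312_iff:
  "contains_pattern n w [3,1,2] \<longleftrightarrow>
    (\<exists>i j k. 1 \<le> i \<and> i < j \<and> j < k \<and> k \<le> n \<and> w j < w k \<and> w k < w i)"
proof
  have len: "length [3,1,2::nat] = 3" by simp
  assume "contains_pattern n w [3,1,2]"
  then obtain idx where idx: "length idx = 3" "sorted_wrt (<) idx" "set idx \<subseteq> {1..n}"
    "\<forall>a<3. \<forall>b<3. w (idx ! a) < w (idx ! b) \<longleftrightarrow> [3,1,2::nat] ! a < [3,1,2] ! b"
    unfolding contains_pattern_def len by blast
  then obtain i j k where ijk: "idx = [i, j, k]"
    by (auto simp: numeral_3_eq_3 length_Suc_conv)
  have "w j < w k" "w k < w i"
    using idx(4)[rule_format, of 1 2] idx(4)[rule_format, of 2 0] by (simp_all add: ijk)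
  with idx ijk show "\<exists>i j k. 1 \<le> i \<and> i < j \<and> j < k \<and> k \<le> n \<and> w j < w k \<and> w k < w i"
    by auto
next
  assume "\<exists>i j k. 1 \<le> i \<and> i < j \<and> j < k \<and> k \<le> n \<and> w j < w k \<and> w k < w i"
  then obtain i j k where "1 \<le> i" "i < j" "j < k" "k \<le> n" "w j < w k" "w k < w i" by blast
  then show "contains_pattern n w [3,1,2]"
    unfolding contains_pattern_def
    by (intro exI[of _ "[i, j, k]"]) (simp add: All_less_Suc numeral_3_eq_3)
qed

lemma contains_1432_iff:
  "contains_pattern n w [1,4,3,2] \<longleftrightarrow>
    (\<exists>h i j k. 1 \<le> h \<and> h < i \<and> i < j \<and> j < k \<and> k \<le> n \<and> w h < w k \<and> w k < w j \<and> w j < w i)"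
proof
  have len: "length [1,4,3,2::nat] = 4" by simp
  assume "contains_pattern n w [1,4,3,2]"
  then obtain idx where idx: "length idx = 4" "sorted_wrt (<) idx" "set idx \<subseteq> {1..n}"
    "\<forall>a<4. \<forall>b<4. w (idx ! a) < w (idx ! b) \<longleftrightarrow> [1,4,3,2::nat] ! a < [1,4,3,2] ! b"
    unfolding contains_pattern_def len by blast
  then obtain h i j k where hijk: "idx = [h, i, j, k]"
    by (auto simp: numeral_eq_Suc length_Suc_conv)
  have "w h < w k" "w k < w j" "w j < w i"
    using idx(4)[rule_format, of 0 3] idx(4)[rule_format, of 3 2] idx(4)[rule_format, of 2 1]
    by (simp_all add: hijk)
  with idx hijk show "\<exists>h i j k. 1 \<le> h \<and> h < i \<and> i < j \<and> j < k \<and> k \<le> n \<and> w h < w k \<and> w k < w j \<and> w j < w i"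
    by auto
next
  assume "\<exists>h i j k. 1 \<le> h \<and> h < i \<and> i < j \<and> j < k \<and> k \<le> n \<and> w h < w k \<and> w k < w j \<and> w j < w i"
  then obtain h i j k where
    "1 \<le> h" "h < i" "i < j" "j < k" "k \<le> n" "w h < w k" "w k < w j" "w j < w i" by blast
  then show "contains_pattern n w [1,4,3,2]"
    unfolding contains_pattern_def
    by (intro exI[of _ "[h, i, j, k]"]) (simp add: All_less_Suc numeral_eq_Suc)
qed

definition avoiding :: "nat \<Rightarrow> (nat \<Rightarrow> nat) \<Rightarrow> bool" where
  "avoiding n w \<longleftrightarrow>
    (\<forall>i j k. 1 \<le> i \<longrightarrow> i < j \<longrightarrow> j < k \<longrightarrow> k \<le> n \<longrightarrow> w j < w k \<longrightarrow> w k < w i \<longrightarrow> False) \<and>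
    (\<forall>h i j k. 1 \<le> h \<longrightarrow> h < i \<longrightarrow> i < j \<longrightarrow> j < k \<longrightarrow> k \<le> n \<longrightarrow>
      w h < w k \<longrightarrow> w k < w j \<longrightarrow> w j < w i \<longrightarrow> False)"

lemma avoiding_iff: "avoiding n w \<longleftrightarrow> avoids n w [3,1,2] \<and> avoids n w [1,4,3,2]"
  unfolding avoids_def contains_312_iff contains_1432_iff avoiding_def by blast

lemma avoidingI:
  assumes "\<And>i j k. \<lbrakk>1 \<le> i; i < j; j < k; k \<le> n; w j < w k; w k < w i\<rbrakk> \<Longrightarrow> False"
    and "\<And>h i j k. \<lbrakk>1 \<le> h; h < i; i < j; j < k; k \<le> n; w h < w k; w k < w j; w j < w i\<rbrakk> \<Longrightarrow> False"
  shows "avoiding n w"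
  using assms unfolding avoiding_def by blast

lemma avoiding_312:
  "avoiding n w \<Longrightarrow> 1 \<le> i \<Longrightarrow> i < j \<Longrightarrow> j < k \<Longrightarrow> k \<le> n \<Longrightarrow> w j < w k \<Longrightarrow> w k < w i \<Longrightarrow> False"
  unfolding avoiding_def by blast

lemma avoiding_1432:
  "avoiding n w \<Longrightarrow> 1 \<le> h \<Longrightarrow> h < i \<Longrightarrow> i < j \<Longrightarrow> j < k \<Longrightarrow> k \<le> n \<Longrightarrow>
    w h < w k \<Longrightarrow> w k < w j \<Longrightarrow> w j < w i \<Longrightarrow> False"
  unfolding avoiding_def by blast

lemma avoiding_restrict:
  assumes "avoiding n w" "m \<le> n" "\<And>i j. \<lbrakk>1 \<le> i; i \<le> m; 1 \<le> j; j \<le> m; u i < u j\<rbrakk> \<Longrightarrow> w i < w j"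
  shows "avoiding m u"
proof (rule avoidingI)
  fix i j k assume "1 \<le> i" "i < j" "j < k" "k \<le> m" "u j < u k" "u k < u i"
  with assms show False by (intro avoiding_312[OF assms(1), of i j k]) auto
next
  fix h i j k assume "1 \<le> h" "h < i" "i < j" "j < k" "k \<le> m" "u h < u k" "u k < u j" "u j < u i"
  with assms show False by (intro avoiding_1432[OF assms(1), of h i j k]) auto
qed

text \<open>The second sequence is the exponent sequence of the Schubert polynomial; the constructors undo
  the removal of the final cycle and of a final value 1, respectively.\<close>

inductive layered :: "nat \<Rightarrow> (nat \<Rightarrow> nat) \<Rightarrow> (nat \<Rightarrow> nat) \<Rightarrow> bool" where
  empty: "layered 0 id (\<lambda>_. 0)"
| cycle: "layered p u a \<Longrightarrow> p < n \<Longrightarrow> layered n (rot p n \<circ> u) (a(n - 1 := n - 1 - p))"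
| shift: "layered n u a \<Longrightarrow> layered (Suc n) (rot 0 (Suc n) \<circ> u) (a(n := n))"

lemma layered_permutes: "layered n w a \<Longrightarrow> w permutes {1..n}"
proof (induction rule: layered.induct)
  case empty
  show ?case by (rule permutes_id)
next
  case (cycle p u a n)
  then show ?case by (intro rot_comp_permutes[of u p n p]) auto
next
  case (shift n u a)
  then show ?case by (intro rot_comp_permutes[of u n "Suc n" 0]) auto
qed

lemma layered_support: "layered n w a \<Longrightarrow> n \<le> i \<Longrightarrow> a i = 0"
  by (induction arbitrary: i rule: layered.induct) auto

text \<open>If the last entry of an occurrence lay beyond position \<open>p\<close>, so would its
  largest entry and the one after it, both before \<open>n\<close>. But values increase on those
  positions. So every occurrence lies within \<open>u\<close>.\<close>

lemma avoiding_rot: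
  assumes u: "u permutes {1..p}" and "avoiding p u" and "p < n"
  shows "avoiding n (rot p n \<circ> u)"
proof -
  let ?w = "rot p n \<circ> u"
  have low: "1 \<le> ?w l" "?w l \<le> p" "?w l = u l" if "1 \<le> l" "l \<le> p" for l
    using permutes_in_image[OF u, of l] that by (auto simp: rot_def)
  have fix_u: "u l = l" if "p < l" for l
    using permutes_not_in[OF u, of l] that by simp
  have mid: "?w l = Suc l" if "p < l" "l < n" for l
    using fix_u that by (simp add: rot_def)
  have last: "?w n = Suc p"
    using fix_u assms(3) by (simp add: rot_def)
  have high: "p < l" if "p < ?w l" "1 \<le> l" for l
    using that low(2)[of l] by (cases "p < l") auto
  have no: False if "p < k" "i < j" "j < k" "k \<le> n" "1 \<le> i" "?w k < ?w j" "?w k < ?w i" "?w j < ?w i" for i j k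
  proof -
    have "p < ?w k" using that mid[of k] last by (cases "k = n") auto
    then have "p < i" "p < j" using that high[of i] high[of j] by simp_all
    then show False using that mid[of i] mid[of j] by simp
  qed
  show ?thesis
  proof (rule avoidingI)
    fix i j k assume ijk: "1 \<le> i" "i < j" "j < k" "k \<le> n" "?w j < ?w k" "?w k < ?w i"
    show False
    proof (cases "k \<le> p")
      case True
      with ijk show False using low(3) by (intro avoiding_312[OF assms(2), of i j k]) auto
    next
      case False
      then have "p < ?w k" using ijk mid[of k] last by (cases "k = n") auto
      with ijk have pi: "p < i" using high[of i] by simp
      with ijk show False using mid[of i] mid[of j] mid[of k] last by (cases "k = n") auto
    qed
  next
    fix h i j k
    assume hijk: "1 \<le> h" "h < i" "i < j" "j < k" "k \<le> n" "?w h < ?w k" "?w k < ?w j" "?w j < ?w i"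
    show False
    proof (cases "k \<le> p")
      case True
      with hijk show False using low(3) by (intro avoiding_1432[OF assms(2), of h i j k]) auto
    next
      case False
      with hijk show False by (intro no[of k i j]) auto
    qed
  qed
qed

text \<open>The appended value 1 is minimal and last, whereas neither pattern ends in its
  minimum.\<close>

lemma avoiding_rot_0:
  assumes u: "u permutes {1..n}" and "avoiding n u"
  shows "avoiding (Suc n) (rot 0 (Suc n) \<circ> u)"
proof -
  let ?w = "rot 0 (Suc n) \<circ> u"
  have low: "?w l = Suc (u l)" "1 < ?w l" if "1 \<le> l" "l \<le> n" for l
    using permutes_in_image[OF u, of l] that by (auto simp: rot_def)
  have last: "?w (Suc n) = 1"
    using permutes_not_in[OF u, of "Suc n"] by (simp add: rot_def)
  show ?thesis
  proof (rule avoidingI)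
    fix i j k assume ijk: "1 \<le> i" "i < j" "j < k" "k \<le> Suc n" "?w j < ?w k" "?w k < ?w i"
    then have "k \<noteq> Suc n" using low(2)[of j] last
      by (metis Suc_leI le_trans less_Suc_eq_le less_asym less_imp_le)
    with ijk show False using low(1) by (intro avoiding_312[OF assms(2), of i j k]) auto
  next
    fix h i j k
    assume hijk: "1 \<le> h" "h < i" "i < j" "j < k" "k \<le> Suc n" "?w h < ?w k" "?w k < ?w j" "?w j < ?w i"
    then have "h \<le> n" by simp
    with hijk have "k \<noteq> Suc n" using low(2)[of h] last by (metis less_asym)
    with hijk show False using low(1) by (intro avoiding_1432[OF assms(2), of h i j k]) auto
  qed
qed

lemma layered_avoiding: "layered n w a \<Longrightarrow> avoiding n w"
proof (induction rule: layered.induct)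
  case empty
  show ?case by (rule avoidingI) auto
next
  case (cycle p u a n)
  then show ?case by (intro avoiding_rot layered_permutes)
next
  case (shift n u a)
  then show ?case by (intro avoiding_rot_0 layered_permutes)
qed

section \<open>Exponent sequences of layered permutations\<close>

lemma sem_upd:
  assumes "\<And>i. m \<le> i \<Longrightarrow> a i = 0" "m \<le> k" "k = 0 \<Longrightarrow> j = 0"
  shows "sem (a(k := j)) = sem a * esym k j"
proof -
  have "sem (a(k := j)) = (\<Prod>l\<in>{1..<Suc k}. esym l ((a(k := j)) l))"
    by (rule sem_eq_prod) (use assms in auto)
  \<comment> \<open>For \<open>k = 0\<close> the product ignores the new value, so the factor has to
    be \<open>esym 0 0 = 1\<close>.\<close>
  also have "\<dots> = (\<Prod>l\<in>{1..<k}. esym l ((a(k := j)) l)) * esym k j"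
    using assms(3) by (cases k) auto
  also have "(\<Prod>l\<in>{1..<k}. esym l ((a(k := j)) l)) = (\<Prod>l\<in>{1..<k}. esym l (a l))"
    by (rule prod.cong) auto
  also have "\<dots> = sem a"
    by (rule sem_eq_prod[symmetric]) (use assms in auto)
  finally show ?thesis .
qed

lemma layered_schubert:
  assumes "layered m w a" "descent_family n F" "m \<le> n"
  shows "F w = sem a"
  using assms
proof (induction arbitrary: n rule: layered.induct)
  case empty
  have "sem (\<lambda>_. 0) = 1" by (simp add: sem_def)
  then show ?case unfolding descent_family_id[OF empty.prems(1)] by simp
next
  case (cycle p u a m)
  have "F (rot p m \<circ> u) = F u * esym (m - 1) (m - 1 - p)"
    by (rule schubert_rot[OF descent_family_mono[OF cycle.prems] cycle.hyps(2)
          layered_permutes[OF cycle.hyps(1)]])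
  also have "F u = sem a" using cycle.prems cycle.hyps by (intro cycle.IH[of n]) auto
  also have "sem a * esym (m - 1) (m - 1 - p) = sem (a(m - 1 := m - 1 - p))"
    by (rule sem_upd[symmetric, of p]) (use cycle layered_support[of p u a] in auto)
  finally show ?case .
next
  case (shift m u a)
  have "F (rot 0 (Suc m) \<circ> u) = F u * esym m m"
    by (rule schubert_rot_0[OF descent_family_mono[OF shift.prems] layered_permutes[OF shift.hyps]])
  also have "F u = sem a" using shift.prems by (intro shift.IH[of n]) auto
  also have "sem a * esym m m = sem (a(m := m))"
    by (rule sem_upd[symmetric, of m]) (use shift layered_support[of m u a] in auto)
  finally show ?case .
qed

text \<open>Let \<open>p + 1\<close> be the last value. Avoiding 312 puts the values up to
  \<open>p\<close> first; for \<open>p > 0\<close>, avoiding 1432 makes the values between these and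
  the last one increase. This is the form \<open>rot p n \<circ> u\<close>.\<close>

lemma layered_if_avoiding:
  assumes "w permutes {1..n}" "avoiding n w"
  shows "\<exists>a. layered n w a"
  using assms
proof (induction n arbitrary: w rule: less_induct)
  case (less n)
  note w = less.prems(1) and av = less.prems(2)
  show ?case
  proof (cases n)
    case 0
    with w have "w = id" by simp
    with 0 layered.empty show ?thesis by blast
  next
    case (Suc m)
    define p where "p = w n - 1"
    define u where "u = inv (rot p n) \<circ> w"
    have wn: "w n = Suc p" "p < n"
      using permutes_in_image[OF w, of n] by (auto simp: p_def Suc)
    have w_eq: "w = rot p n \<circ> u"
      using permutes_inverses[OF rot_permutes] by (simp add: u_def fun_eq_iff)
    have u: "u permutes {1..n}"
      unfolding u_def by (intro permutes_compose[OF w] permutes_inv[OF rot_permutes])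
    have "rot p n n = w n" using wn by (simp add: rot_def)
    then have "rot p n (u n) = rot p n n" by (simp add: w_eq)
    then have un: "u n = n" using permutes_neq[OF rot_permutes] by blast
    have u_less: "u l \<in> {1..<n}" if "l \<in> {1..<n}" for l
      using permutes_in_image[OF u, of l] permutes_neq[OF u, of l n] that un by auto
    have mono: "w i < w j" if "i \<in> {1..<n}" "j \<in> {1..<n}" "u i < u j" for i j
      using rot_strict_mono[of "u i" "u j" n p] that u_less[of j] by (simp add: w_eq)
    show ?thesis
    proof (cases "p = 0")
      case True
      have um: "u permutes {1..m}"
        by (rule permutes_superset[OF u]) (use un in \<open>auto simp: Suc le_Suc_eq\<close>)
      moreover have "avoiding m u"
        by (rule avoiding_restrict[OF av]) (use Suc in \<open>auto intro: mono\<close>)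
      ultimately obtain a where "layered m u a" using less.IH[of m u] Suc by auto
      then show ?thesis using layered.shift[of m u a] unfolding w_eq True Suc by blast
    next
      case False
      define S where "S = {l \<in> {1..n}. w l \<le> p}"
      have "w ` S = {1..p}"
      proof -
        have "w ` S = w ` {1..n} \<inter> {..p}" by (auto simp: S_def)
        also have "\<dots> = {1..p}" unfolding permutes_image[OF w] using wn by auto
        finally show ?thesis .
      qed
      then have card_S: "card S = p"
        using card_image[OF inj_on_subset[OF permutes_inj[OF w]], of S] by simp
      \<comment> \<open>A value above \<open>p + 1\<close> before a value of at most
        \<open>p\<close> would form 312 with the last value. So \<open>S\<close> is an initial
        segment.\<close>
      have down: "i \<in> S" if "j \<in> S" "1 \<le> i" "i < j" for i j
      proof (rule ccontr)
        assume "i \<notin> S"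
        with that have i: "p < w i" by (auto simp: S_def)
        have j: "j \<noteq> n" "w j \<le> p" "j \<le> n" using that wn by (auto simp: S_def)
        have "w i \<noteq> w n" using permutes_neq[OF w, of i n] that j by auto
        with i j that wn show False
          by (intro avoiding_312[OF av, of i j n]) auto
      qed
      have "S \<subseteq> {1..p}"
      proof
        fix j assume j: "j \<in> S"
        have "{1..j} \<subseteq> S"
        proof
          fix i assume "i \<in> {1..j}"
          with j down[OF j, of i] show "i \<in> S" by (cases "i = j") auto
        qed
        then have "card {1..j} \<le> card S" by (intro card_mono) (auto simp: S_def)
        with card_S j show "j \<in> {1..p}" by (simp add: S_def)
      qed
      then have S: "S = {1..p}" by (intro card_subset_eq) (auto simp: card_S)
      have incr: "w i < w (Suc i)" if "p < i" "Suc i < n" for i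
      proof (rule ccontr)
        assume "\<not> w i < w (Suc i)"
        then have "w (Suc i) < w i" using permutes_neq[OF w, of i "Suc i"] by simp
        moreover have "w n < w (Suc i)"
        proof -
          have "Suc i \<notin> S" using that by (simp add: S)
          then have "p < w (Suc i)" using that by (simp add: S_def)
          with permutes_neq[OF w, of "Suc i" n] that wn show ?thesis by simp
        qed
        moreover have "w 1 < w n"
        proof -
          have "1 \<in> S" using False by (simp add: S)
          then show ?thesis using wn by (simp add: S_def)
        qed
        ultimately show False
          using that False by (intro avoiding_1432[OF av, of 1 i "Suc i" n]) auto
      qed
      \<comment> \<open>Strictly increasing values on positions \<open>p + 1\<close> to
        \<open>n - 1\<close>, at least \<open>p + 2\<close> and at most \<open>n\<close>, leave only
        \<open>w l = Suc l\<close>.\<close>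
      have ge: "Suc l \<le> w l" if "Suc p \<le> l" "l < n" for l
        using that
      proof (induction l rule: dec_induct)
        case base
        then have "Suc p \<notin> S" by (simp add: S)
        then have "p < w (Suc p)" using base by (simp add: S_def)
        with permutes_neq[OF w, of "Suc p" n] base wn show ?case by simp
      next
        case (step l)
        then show ?case using incr[of l] by simp
      qed
      have le: "w l \<le> Suc l" if "l \<le> m" "p < l" for l
        using that
      proof (induction l rule: inc_induct)
        case base
        then show ?case using permutes_in_image[OF w, of m] by (simp add: Suc)
      next
        case (step l)
        then show ?case using incr[of l] by (simp add: Suc)
      qed
      have fix_u: "u l = l" if "p < l" for l
      proof -
        consider "l < n" | "l = n" | "n < l" by linarith
        then show ?thesis
        proof cases
          case 1
          then have "rot p n (u l) = rot p n l"
            using ge[of l] le[of l] that by (simp add: Suc) (simp add: w_eq rot_def Suc)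
          then show ?thesis using permutes_neq[OF rot_permutes] by blast
        next
          case 3
          then show ?thesis using permutes_not_in[OF u, of l] by simp
        qed (simp add: un)
      qed
      have up: "u permutes {1..p}"
        by (rule permutes_superset[OF u]) (use fix_u in auto)
      moreover have "avoiding p u"
        by (rule avoiding_restrict[OF av]) (use wn in \<open>auto intro: mono\<close>)
      ultimately obtain a where "layered p u a" using less.IH[of p u] wn by auto
      then show ?thesis using layered.cycle[of p u a n] wn unfolding w_eq by blast
    qed
  qed
qed

text \<open>Recursion on the last index \<open>m = n - 1\<close>. If \<open>a m = m\<close>,
  \<open>shift\<close> applies. Otherwise separation makes the remaining sequence vanish from
  \<open>m - a m\<close> on, so it belongs to a permutation of \<open>{1..m - a m}\<close> and
  \<open>cycle\<close> applies.\<close>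

lemma layered_if_separated:
  assumes "\<And>i. n \<le> i \<Longrightarrow> a i = 0" and "\<And>i. a i \<le> i"
    and "\<And>i j. \<lbrakk>0 < a i; a i < i; i - a i \<le> j; j < i\<rbrakk> \<Longrightarrow> a j = 0"
  shows "\<exists>w. layered n w a"
  using assms
proof (induction n arbitrary: a rule: less_induct)
  case (less n)
  show ?case
  proof (cases n)
    case 0
    have "a = (\<lambda>_. 0)"
    proof
      fix l show "a l = 0" by (rule less.prems(1)) (simp add: 0)
    qed
    then have "layered n id a" using layered.empty 0 by simp
    then show ?thesis by (intro exI[where x = id])
  next
    case (Suc m)
    define b where "b = a(m := 0)"
    have b_le: "b i \<le> i" for i
      using less.prems(2)[of i] by (simp add: b_def)
    have b_sep: "b j = 0" if "0 < b i" "b i < i" "i - b i \<le> j" "j < i" for i j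
    proof -
      have "b i = a i" using that(1) by (cases "i = m") (simp_all add: b_def)
      with that less.prems(3)[of i j] have "a j = 0" by simp
      then show ?thesis by (simp add: b_def)
    qed
    have b_supp: "b i = 0" if "m \<le> i" for i
      using less.prems(1)[of i] that by (cases "i = m") (simp_all add: b_def Suc)
    show ?thesis
    proof (cases "a m = m")
      case True
      have "\<exists>u. layered m u b"
        by (rule less.IH[OF _ b_supp b_le b_sep]) (simp_all add: Suc)
      moreover have "b(m := m) = a" using True by (auto simp: b_def)
      ultimately show ?thesis unfolding Suc by (metis layered.shift)
    next
      case False
      define p where "p = m - a m"
      have p: "p < n" "n - 1 - p = a m" "n - 1 = m"
        using less.prems(2)[of m] False by (auto simp: p_def Suc)
      have b_zero: "b i = 0" if "p \<le> i" for i
      proof (cases "i < m")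
        case True
        then show ?thesis
          using less.prems(3)[of m i] less.prems(2)[of m] that False
          by (cases "a m = 0") (auto simp: b_def p_def)
      next
        case False
        then show ?thesis using less.prems(1)[of i] by (simp add: b_def Suc)
      qed
      have "\<exists>u. layered p u b"
      proof (rule less.IH[OF p(1)])
        show "b j = 0" if "0 < b i" "b i < i" "i - b i \<le> j" "j < i" for i j
          using that by (rule b_sep)
      qed (simp_all add: b_zero b_le)
      moreover have "b(n - 1 := n - 1 - p) = a" unfolding p(2) unfolding p(3) by (auto simp: b_def)
      ultimately show ?thesis using p(1) by (metis layered.cycle)
    qed
  qed
qed

section \<open>Exponent sequences of Schubert polynomials\<close>

lemma is_ddiff_neq_0:
  assumes "is_ddiff i f g" "g \<noteq> 0"
  shows "f \<noteq> 0"
proof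
  assume "f = 0"
  then have "is_ddiff i f 0" by (simp add: is_ddiff_symmetric)
  with assms show False using is_ddiff_unique by metis
qed

lemma is_ddiff_esym_mult:
  assumes "1 \<le> i" "1 \<le> j" "swap_var i h = h"
  shows "is_ddiff i (esym i j * h) (esym (i - 1) (j - 1) * h)"
  using assms by (intro is_ddiff_mult_symmetric is_ddiff_esym)

text \<open>Hides the permutation, so that chains of divided differences can be followed on
  polynomials alone.\<close>

definition is_schubert :: "nat \<Rightarrow> ((nat \<Rightarrow> nat) \<Rightarrow> mpoly) \<Rightarrow> mpoly \<Rightarrow> bool" where
  "is_schubert n F f \<longleftrightarrow> (\<exists>w. w permutes {1..n} \<and> F w = f)"

lemma is_schubert_ddiff:
  assumes "descent_family n F" "is_schubert n F f" "1 \<le> i" "i < n" "is_ddiff i f g" "g \<noteq> 0"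
  shows "is_schubert n F g"
proof -
  obtain w where w: "w permutes {1..n}" "F w = f" using assms(2) by (auto simp: is_schubert_def)
  with assms have "F (w \<circ> transpose i (Suc i)) = g"
    by (intro descent_family_nonzero(2)) auto
  with permutes_transpose[OF w(1) assms(3,4)] show ?thesis
    unfolding is_schubert_def by blast
qed

lemma permutes_comp_cancel: "w permutes A \<Longrightarrow> w \<circ> f = w \<circ> g \<Longrightarrow> f x = g x"
  by (metis comp_apply injD permutes_inj)

text \<open>By injectivity the two adjacent transpositions would coincide.\<close>

lemma not_is_schubert_equal_ddiffs:
  assumes "descent_family n F" "is_schubert n F f" "1 \<le> i" "i < j" "j < n"
    and "is_ddiff i f g" "is_ddiff j f g" "g \<noteq> 0"
  shows False
proof -
  obtain w where w: "w permutes {1..n}" "F w = f" using assms(2) by (auto simp: is_schubert_def)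
  have "F (w \<circ> transpose i (Suc i)) = g" "F (w \<circ> transpose j (Suc j)) = g"
    using assms w by (auto intro!: descent_family_nonzero(2)[OF assms(1)])
  then have "w \<circ> transpose i (Suc i) = w \<circ> transpose j (Suc j)"
    using assms by (intro descent_family_inj[OF assms(1)] permutes_transpose[OF w(1)]) auto
  from permutes_comp_cancel[OF w(1) this, of "Suc j"] assms(4) show False
    by (simp add: transpose_def split: if_splits)
qed

text \<open>By injectivity two neighbouring adjacent transpositions would commute.\<close>

lemma not_is_schubert_commuting_ddiffs:
  assumes fam: "descent_family n F" and "is_schubert n F f" and i: "1 \<le> i" "Suc i < n"
    and g: "is_ddiff i f g" "is_ddiff (Suc i) g h"
    and g': "is_ddiff (Suc i) f g'" "is_ddiff i g' h" and "h \<noteq> 0"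
  shows False
proof -
  let ?s = "transpose i (Suc i)" and ?t = "transpose (Suc i) (Suc (Suc i))"
  obtain w where w: "w permutes {1..n}" "F w = f" using assms(2) by (auto simp: is_schubert_def)
  have i': "i < n" "1 \<le> Suc i" using i by auto
  have ws: "w \<circ> ?s permutes {1..n}" and wt: "w \<circ> ?t permutes {1..n}"
    by (rule permutes_transpose[OF w(1) i(1) i'(1)], rule permutes_transpose[OF w(1) i'(2) i(2)])
  have "g \<noteq> 0" "g' \<noteq> 0" using g g' \<open>h \<noteq> 0\<close> is_ddiff_neq_0 by metis+
  then have "F (w \<circ> ?s) = g" "F (w \<circ> ?t) = g'"
    using descent_family_nonzero(2)[OF fam w(1) i(1) i'(1)]
      descent_family_nonzero(2)[OF fam w(1) i'(2) i(2)] g(1) g'(1) w(2) by metis+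
  then have "F (w \<circ> ?s \<circ> ?t) = h" "F (w \<circ> ?t \<circ> ?s) = h"
    using descent_family_nonzero(2)[OF fam ws i'(2) i(2)]
      descent_family_nonzero(2)[OF fam wt i(1) i'(1)] g(2) g'(2) \<open>h \<noteq> 0\<close> by metis+
  moreover have "w \<circ> ?s \<circ> ?t permutes {1..n}" "w \<circ> ?t \<circ> ?s permutes {1..n}"
    using permutes_transpose[OF ws i'(2) i(2)] permutes_transpose[OF wt i(1) i'(1)] by blast+
  ultimately have "w \<circ> ?s \<circ> ?t = w \<circ> ?t \<circ> ?s"
    by (intro descent_family_inj[OF fam]) auto
  then have "w \<circ> (?s \<circ> ?t) = w \<circ> (?t \<circ> ?s)" by (simp only: comp_assoc)
  from permutes_comp_cancel[OF w(1) this, of i] show False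
    by (simp add: transpose_def split: if_splits)
qed

text \<open>The divided differences at \<open>i\<close>, \<open>i - 1\<close>, ...,
  \<open>i - t + 1\<close> act one after the other on the first factor only.\<close>

lemma is_schubert_chain:
  assumes fam: "descent_family n F" and "is_schubert n F (esym i b * R)"
    and "t \<le> b" "b \<le> i" "i < n" "R \<noteq> 0"
    and R: "\<And>l. i - t < l \<Longrightarrow> l \<le> i \<Longrightarrow> swap_var l R = R"
  shows "is_schubert n F (esym (i - t) (b - t) * R)"
  using assms(3) R
proof (induction t)
  case 0
  then show ?case using assms(2) by simp
next
  case (Suc t)
  have f: "is_schubert n F (esym (i - t) (b - t) * R)"
    using Suc.prems by (intro Suc.IH) auto
  have "is_ddiff (i - t) (esym (i - t) (b - t) * R) (esym (i - t - 1) (b - t - 1) * R)"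
    using Suc.prems assms(4) by (intro is_ddiff_esym_mult) auto
  moreover have "esym (i - t - 1) (b - t - 1) * R \<noteq> 0"
    using assms(4,6) esym_nonzero[of "b - t - 1" "i - t - 1"] by simp
  ultimately have "is_schubert n F (esym (i - t - 1) (b - t - 1) * R)"
    using Suc.prems assms(4,5) by (intro is_schubert_ddiff[OF fam f, of "i - t"]) auto
  then show ?case by simp
qed

text \<open>Two chains reduce the product to \<open>esym k (q - p) * (esym (Suc k) 1 * H)\<close>.
  There the divided differences at \<open>k\<close> and \<open>Suc k\<close> act on different
  factors, so both orders give the same nonzero result.\<close>

lemma not_is_schubert_overlap_less:
  assumes fam: "descent_family n F" and "is_schubert n F (esym j q * (esym i (i - j + p) * H))"
    and "p < q" "q \<le> j" "j < i" "i < n" "H \<noteq> 0"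
    and H: "\<And>l. 1 \<le> l \<Longrightarrow> l \<le> i \<Longrightarrow> swap_var l H = H"
  shows False
proof -
  \<comment> \<open>With this \<open>k\<close> the second degree is \<open>i - k\<close>, so
    lowering that factor to degree 1 stops at index \<open>Suc k\<close>, next to the first
    factor.\<close>
  define k where "k = j - p"
  have k: "1 \<le> k" "q - p \<le> k" "k < i" "k \<le> j" "i - j + p = i - k"
    using assms(3-5) by (auto simp: k_def)
  have "is_schubert n F (esym (j - p) (q - p) * (esym i (i - j + p) * H))"
    using assms k esym_nonzero[of "i - j + p" i]
    by (intro is_schubert_chain[OF fam assms(2)]) (auto simp: swap_var_mult swap_var_esym)
  then have f: "is_schubert n F (esym i (i - k) * (esym k (q - p) * H))"
    by (simp add: k(5) mult.left_commute flip: k_def)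
  have "is_schubert n F (esym (i - (i - k - 1)) (i - k - (i - k - 1)) * (esym k (q - p) * H))"
    using assms k esym_nonzero[of "q - p" k]
    by (intro is_schubert_chain[OF fam f]) (auto simp: swap_var_mult swap_var_esym)
  moreover have "i - (i - k - 1) = Suc k" "i - k - (i - k - 1) = 1" using k by auto
  ultimately have f': "is_schubert n F (esym k (q - p) * (esym (Suc k) 1 * H))"
    by (simp add: mult.left_commute)
  show False
  proof (rule not_is_schubert_commuting_ddiffs[OF fam f'])
    show "is_ddiff k (esym k (q - p) * (esym (Suc k) 1 * H))
        (esym (k - 1) (q - p - 1) * (esym (Suc k) 1 * H))"
      using assms k by (intro is_ddiff_esym_mult) (auto simp: swap_var_mult swap_var_esym)
    show "is_ddiff k (esym k (q - p) * (1 * H)) (esym (k - 1) (q - p - 1) * (1 * H))"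
      using assms k by (intro is_ddiff_esym_mult) (auto simp: swap_var_mult)
    have *: "is_ddiff (Suc k) (esym (Suc k) 1 * H) (1 * H)"
      using assms k is_ddiff_esym_mult[of "Suc k" 1 H] by simp
    show "is_ddiff (Suc k) (esym (k - 1) (q - p - 1) * (esym (Suc k) 1 * H))
        (esym (k - 1) (q - p - 1) * (1 * H))"
      by (intro is_ddiff_symmetric_mult * swap_var_esym) auto
    show "is_ddiff (Suc k) (esym k (q - p) * (esym (Suc k) 1 * H)) (esym k (q - p) * (1 * H))"
      by (intro is_ddiff_symmetric_mult * swap_var_esym) auto
    show "esym (k - 1) (q - p - 1) * (1 * H) \<noteq> 0"
      using assms k esym_nonzero[of "q - p - 1" "k - 1"] by simp
  qed (use k assms in auto)
qed

text \<open>In the Leibniz rule the contributions of \<open>X m\<close> and \<open>X (Suc m)\<close>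
  combine to \<open>esym (Suc m) 1\<close>, which divided differences at lower indices treat as a
  constant.\<close>

lemma is_ddiff_esym_1_esym:
  assumes "1 \<le> m" "1 \<le> r"
  shows "is_ddiff m (esym m r * esym m 1)
    (esym (m - 1) r + esym (Suc m) 1 * esym (m - 1) (r - 1))"
proof -
  obtain m' r' where mr: "m = Suc m'" "r = Suc r'" using assms by (metis Suc_le_D One_nat_def)
  have "is_ddiff m (esym m 1 * esym m r)
      (esym (m - 1) (1 - 1) * esym m r + swap_var m (esym m 1) * esym (m - 1) (r - 1))"
    using assms by (intro is_ddiff_mult is_ddiff_esym) auto
  moreover have "swap_var m (esym m 1) = esym (m - 1) 1 + X (Suc m)"
    using assms(1) by (simp add: mr esym_Suc swap_var_add swap_var_X swap_var_esym)
  ultimately show ?thesis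
    by (simp add: mr esym_Suc algebra_simps)
qed

text \<open>Divided differences from \<open>m\<close> downwards lead to
  \<open>(esym (m - r) 1 + esym (Suc m) 1) * H\<close>. There the divided differences at
  \<open>m - r\<close> and at \<open>Suc m\<close> both give \<open>H\<close>.\<close>

lemma not_is_schubert_same_index:
  assumes fam: "descent_family n F" and "is_schubert n F (esym m r * (esym m 1 * H))"
    and "1 \<le> r" "r < m" "Suc m < n" "H \<noteq> 0"
    and H: "\<And>l. 1 \<le> l \<Longrightarrow> l \<le> Suc m \<Longrightarrow> swap_var l H = H"
  shows False
proof -
  let ?E = "esym (Suc m) 1"
  \<comment> \<open>The result of the divided differences at \<open>m\<close>, ...,
    \<open>m - t\<close>.\<close>
  define G where "G t = (esym (m - 1 - t) (r - t) + ?E * esym (m - 1 - t) (r - 1 - t)) * H" for t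
  have ddE: "is_ddiff (Suc m) ?E 1"
    using is_ddiff_esym[of "Suc m" 1] by simp
  have top: "is_ddiff (Suc m) (G t) (esym (m - 1 - t) (r - 1 - t) * H)" for t
  proof -
    have "is_ddiff (Suc m) (G t) ((0 + 1 * esym (m - 1 - t) (r - 1 - t)) * H)"
      unfolding G_def
      by (intro is_ddiff_add is_ddiff_mult_symmetric is_ddiff_symmetric ddE swap_var_esym H) auto
    then show ?thesis by simp
  qed
  have neq: "G t \<noteq> 0" if "t < r" for t
    using that assms(4,6) esym_nonzero[of "r - 1 - t" "m - 1 - t"]
    by (intro is_ddiff_neq_0[OF top]) auto
  have "is_schubert n F (G t)" if "t < r" for t
    using that
  proof (induction t)
    case 0
    have "is_ddiff m (esym m r * (esym m 1 * H)) (G 0)"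
      unfolding G_def mult.assoc[symmetric]
      using is_ddiff_esym_1_esym[of m r] assms by (intro is_ddiff_mult_symmetric) auto
    then show ?case using assms neq by (intro is_schubert_ddiff[OF fam assms(2)]) auto
  next
    case (Suc t)
    have "is_ddiff (m - 1 - t) (G t)
        ((esym (m - 1 - t - 1) (r - t - 1) + ?E * esym (m - 1 - t - 1) (r - 1 - t - 1)) * H)"
      unfolding G_def using Suc.prems assms(4)
      by (intro is_ddiff_add is_ddiff_mult_symmetric is_ddiff_symmetric_mult is_ddiff_esym
            swap_var_esym H) auto
    then have "is_ddiff (m - 1 - t) (G t) (G (Suc t))" by (simp add: G_def)
    with Suc neq assms(4,5) show ?case by (intro is_schubert_ddiff[OF fam Suc.IH]) auto
  qed
  from this[of "r - 1"] assms(3) have f: "is_schubert n F (G (r - 1))" by simp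
  have r: "r - (r - 1) = 1" "r - 1 - (r - 1) = 0" "m - 1 - (r - 1) = m - r" using assms(3) by auto
  have "is_ddiff (m - r) (G (r - 1)) ((esym (m - r - 1) (1 - 1) + 0) * H)"
    unfolding G_def r using assms
    by (intro is_ddiff_add is_ddiff_mult_symmetric is_ddiff_esym is_ddiff_symmetric H)
       (auto simp: swap_var_esym)
  then have "is_ddiff (m - r) (G (r - 1)) H" by simp
  moreover have "is_ddiff (Suc m) (G (r - 1)) H" using top[of "r - 1"] by (simp add: r)
  ultimately show False
    using assms by (intro not_is_schubert_equal_ddiffs[OF fam f, of "m - r" "Suc m" H]) auto
qed

section \<open>Conditions on the exponent sequence of a Schubert polynomial\<close>

context
  fixes n N :: nat and a :: "nat \<Rightarrow> nat" and F :: "(nat \<Rightarrow> nat) \<Rightarrow> mpoly"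
  assumes fam: "descent_family n F" and "is_schubert n F (sem a)"
    and le: "\<And>l. a l \<le> l" and supp: "\<And>l. N \<le> l \<Longrightarrow> a l = 0"
begin

definition tail :: "nat \<Rightarrow> mpoly" where
  "tail k = (\<Prod>l\<in>{k..<N}. esym l (a l))"

lemma tail_Suc: "tail k = esym k (a k) * tail (Suc k)"
proof (cases "k < N")
  case True
  then show ?thesis unfolding tail_def by (rule prod.atLeast_Suc_lessThan)
next
  case False
  then show ?thesis using supp[of k] by (simp add: tail_def)
qed

lemma tail_nonzero: "tail k \<noteq> 0"
  by (simp add: tail_def esym_nonzero le)

lemma swap_var_tail: "1 \<le> l \<Longrightarrow> l < k \<Longrightarrow> swap_var l (tail k) = tail k"
  unfolding tail_def by (rule swap_var_prod_esym) auto

lemma tail_skip: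
  assumes "i \<le> j" "\<And>l. i \<le> l \<Longrightarrow> l < j \<Longrightarrow> a l = 0"
  shows "tail i = tail j"
  using assms
proof (induction j rule: dec_induct)
  case (step j)
  then show ?case by (simp add: tail_Suc[of j])
qed simp

text \<open>A chain of \<open>a k\<close> divided differences lowers the leading factor
  \<open>esym k (a k)\<close> to degree 0, that is, to 1.\<close>

lemma is_schubert_tail:
  assumes "k \<le> n" "1 \<le> k"
  shows "is_schubert n F (tail k)"
  using assms(2,1)
proof (induction k rule: dec_induct)
  case base
  then show ?case
    using \<open>is_schubert n F (sem a)\<close> sem_eq_prod[of N a] supp by (simp add: tail_def)
next
  case (step k)
  then have f: "is_schubert n F (esym k (a k) * tail (Suc k))"
    using tail_Suc[of k] by simp
  have "is_schubert n F (esym (k - a k) (a k - a k) * tail (Suc k))"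
    using step le tail_nonzero by (intro is_schubert_chain[OF fam f]) (auto intro!: swap_var_tail)
  then show ?case by simp
qed

text \<open>All divided differences of \<open>tail n\<close> at indices below \<open>n\<close>
  vanish, so it belongs to the identity and equals 1. A first nonzero entry at
  \<open>d \<ge> n\<close> would give it a nonzero divided difference at \<open>d\<close>.\<close>

lemma sem_support:
  assumes "n \<le> i"
  shows "a i = 0"
proof (rule ccontr)
  assume "a i \<noteq> 0"
  define d where "d = (LEAST l. n \<le> l \<and> a l \<noteq> 0)"
  have d: "n \<le> d" "a d \<noteq> 0"
    using LeastI[of "\<lambda>l. n \<le> l \<and> a l \<noteq> 0" i] assms \<open>a i \<noteq> 0\<close> by (auto simp: d_def)
  have least: "a l = 0" if "n \<le> l" "l < d" for l
    using not_less_Least[of l "\<lambda>l. n \<le> l \<and> a l \<noteq> 0"] that by (auto simp: d_def)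
  have d1: "1 \<le> d" "1 \<le> a d" using le[of d] d by auto
  have "tail n = tail d" using d least by (intro tail_skip) auto
  have "tail d = 1"
  proof (cases "n = 0")
    \<comment> \<open>Here \<open>is_schubert_tail\<close> does not apply, but the identity is the
      only permutation of the empty set.\<close>
    case True
    have "sem a = tail 1" using sem_eq_prod[of N a] supp by (simp add: tail_def)
    also have "\<dots> = tail d" using d1 least True by (intro tail_skip) auto
    finally have "is_schubert n F (tail d)" using \<open>is_schubert n F (sem a)\<close> by simp
    then obtain w where "w permutes {1..n}" and Fw: "F w = tail d" by (auto simp: is_schubert_def)
    then have "w = id" using True by simp
    with Fw descent_family_id[OF fam] show ?thesis by metis
  next
    case False
    then obtain w where w: "w permutes {1..n}" "F w = tail n"
      using is_schubert_tail[of n] by (auto simp: is_schubert_def)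
    have "w = id"
    proof (rule increasing_permutes_eq_id[OF w(1)])
      fix i assume i: "1 \<le> i" "i < n"
      have "is_ddiff i (F w) 0" using i by (simp add: w(2) is_ddiff_symmetric swap_var_tail)
      with descent_family_descent[OF fam w(1) i] descent_family_neq_0[OF fam]
        permutes_transpose[OF w(1) i]
      have "\<not> w (Suc i) < w i" by metis
      with permutes_neq[OF w(1), of i "Suc i"] show "w i < w (Suc i)" by simp
    qed
    with w \<open>tail n = tail d\<close> descent_family_id[OF fam] show ?thesis by metis
  qed
  moreover have "is_ddiff d (tail d) (esym (d - 1) (a d - 1) * tail (Suc d))"
    unfolding tail_Suc[of d] using d1 by (intro is_ddiff_esym_mult swap_var_tail) auto
  moreover have "is_ddiff d 1 0" by (simp add: is_ddiff_symmetric)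
  ultimately have "esym (d - 1) (a d - 1) * tail (Suc d) = 0"
    using is_ddiff_unique by metis
  moreover have "a d - 1 \<le> d - 1" using le[of d] by simp
  ultimately show False using tail_nonzero[of "Suc d"] esym_nonzero[of "a d - 1" "d - 1"] by simp
qed

text \<open>A violation can be moved to the nearest nonzero entry \<open>k\<close> below
  \<open>i\<close>, so that the two offending factors are adjacent in \<open>tail k\<close>. With
  \<open>a i = i - k + p\<close>, the cases \<open>p < a k\<close> and \<open>a k \<le> p\<close>
  lead to the two excluded products.\<close>

lemma sem_separated:
  assumes "0 < a i" "a i < i" "i - a i \<le> j" "j < i"
  shows "a j = 0"
proof (rule ccontr)
  assume "a j \<noteq> 0"
  define k where "k = (GREATEST l. l < i \<and> a l \<noteq> 0)"
  have k: "k < i" "a k \<noteq> 0"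
    using GreatestI_nat[of "\<lambda>l. l < i \<and> a l \<noteq> 0" j i] assms \<open>a j \<noteq> 0\<close> by (auto simp: k_def)
  have "j \<le> k"
    unfolding k_def using assms \<open>a j \<noteq> 0\<close> by (intro Greatest_le_nat[of _ _ i]) auto
  have zero: "a l = 0" if "k < l" "l < i" for l
    using Greatest_le_nat[of "\<lambda>l. l < i \<and> a l \<noteq> 0" l i] that by (force simp: k_def)
  have i: "i < n" using sem_support[of i] assms(1) by (cases "n \<le> i") auto
  define p where "p = a i - (i - k)"
  define H where "H = tail (Suc i)"
  have k1: "1 \<le> k" "a k \<le> k" using le[of k] k by auto
  have p: "a i = i - k + p" "p < k" using assms \<open>j \<le> k\<close> k by (auto simp: p_def)
  have H: "H \<noteq> 0" "\<And>l. 1 \<le> l \<Longrightarrow> l \<le> i \<Longrightarrow> swap_var l H = H"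
    by (auto simp: H_def tail_nonzero swap_var_tail)
  have "tail (Suc k) = tail i" using k zero by (intro tail_skip) auto
  then have f: "is_schubert n F (esym k (a k) * (esym i (i - k + p) * H))"
    using is_schubert_tail[of k] i k k1 by (simp add: tail_Suc[of k] tail_Suc[of i] H_def p(1))
  show False
  proof (cases "p < a k")
    case True
    then show False using k k1 i H by (intro not_is_schubert_overlap_less[OF fam f]) auto
  next
    case False
    \<comment> \<open>Lowering the factor at \<open>k\<close> by \<open>q\<close> steps leaves
      degree 1 at index \<open>m\<close>; lowering the factor at \<open>i\<close> by
      \<open>i - m\<close> steps brings it to the same index, with degree \<open>r\<close>.\<close>
    define q where "q = a k - 1"
    define m where "m = k - q"
    define r where "r = p - q"
    have q: "a k = Suc q" "q < p" using k False by (auto simp: q_def)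
    have m: "m \<le> k" "r < m" "1 \<le> r" using q p by (auto simp: m_def r_def)
    have "is_schubert n F (esym (k - q) (a k - q) * (esym i (i - k + p) * H))"
      using q k k1 p i H esym_nonzero[of "i - k + p" i]
      by (intro is_schubert_chain[OF fam f]) (auto simp: swap_var_mult swap_var_esym)
    then have f': "is_schubert n F (esym i (i - k + p) * (esym m 1 * H))"
      by (simp add: q m_def mult.left_commute)
    have "is_schubert n F (esym (i - (i - m)) (i - k + p - (i - m)) * (esym m 1 * H))"
      using q k k1 p i H m esym_nonzero[of 1 m]
      by (intro is_schubert_chain[OF fam f']) (auto simp: swap_var_mult swap_var_esym m_def)
    moreover have "i - (i - m) = m" "i - k + p - (i - m) = r"
      using m k q k1 by (auto simp: m_def r_def)
    ultimately show False
      using m i k H by (intro not_is_schubert_same_index[OF fam, of m r H]) auto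
  qed
qed

end

theorem theorem2:
  fixes n :: nat and w :: "nat \<Rightarrow> nat" and F :: "(nat \<Rightarrow> nat) \<Rightarrow> mpoly"
  assumes "n \<ge> 1" and "w permutes {1..n}" and "schubert_family n F"
  shows "is_sem (F w) \<longleftrightarrow> avoids n w [3,1,2] \<and> avoids n w [1,4,3,2]"
proof -
  have fam: "descent_family n F"
    using assms(3) by (rule schubert_family_imp_descent_family)
  have "is_sem (F w) \<longleftrightarrow> avoiding n w"
  proof
    assume "avoiding n w"
    then obtain a where a: "layered n w a" using layered_if_avoiding assms(2) by blast
    have "{i. a i \<noteq> 0} \<subseteq> {..<n}"
    proof
      fix i assume "i \<in> {i. a i \<noteq> 0}"
      then show "i \<in> {..<n}" using layered_support[OF a, of i] by (cases "n \<le> i") auto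
    qed
    then have "finite {i. a i \<noteq> 0}" using finite_subset by blast
    with layered_schubert[OF a fam] show "is_sem (F w)" unfolding is_sem_def by blast
  next
    assume "is_sem (F w)"
    then obtain a0 where a0: "finite {i. a0 i \<noteq> 0}" "F w = sem a0"
      unfolding is_sem_def by blast
    \<comment> \<open>Resetting the entry at 0, which \<open>sem\<close> ignores, is needed for the
      bound \<open>a i \<le> i\<close>.\<close>
    define a where "a = a0(0 := 0)"
    have "{i. 1 \<le> i \<and> a i \<noteq> 0} = {i. 1 \<le> i \<and> a0 i \<noteq> 0}" by (auto simp: a_def)
    then have "sem a = sem a0"
      unfolding sem_def by (rule prod.cong) (simp add: a_def)
    with a0(2) have Fw: "F w = sem a" by simp
    obtain N where "\<forall>i\<in>{i. a0 i \<noteq> 0}. i < N"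
      using a0(1) finite_nat_set_iff_bounded by blast
    then have supp: "a i = 0" if "N \<le> i" for i
      using that by (auto simp: a_def)
    \<comment> \<open>An entry exceeding its index would make a factor, and hence the Schubert
      polynomial, zero.\<close>
    have le: "a i \<le> i" for i
    proof (rule ccontr)
      assume i: "\<not> a i \<le> i"
      then have "esym i (a i) = 0" by (simp add: esym_eq_0)
      moreover have "i \<in> {1..<N}" using i supp[of i] by (cases "N \<le> i"; cases i) (auto simp: a_def)
      ultimately have "(\<Prod>l\<in>{1..<N}. esym l (a l)) = 0"
        by (intro prod_zero) auto
      moreover have "sem a = (\<Prod>l\<in>{1..<N}. esym l (a l))"
        by (rule sem_eq_prod) (rule supp)
      ultimately have "sem a = 0" by simp
      with Fw descent_family_neq_0[OF fam assms(2)] show False by simp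
    qed
    have "is_schubert n F (sem a)"
      using assms(2) Fw unfolding is_schubert_def by blast
    note context_facts = fam this le supp
    have "\<exists>v. layered n v a"
    proof (rule layered_if_separated)
      show "a i = 0" if "n \<le> i" for i
        using context_facts that by (rule sem_support)
      show "a j = 0" if "0 < a i" "a i < i" "i - a i \<le> j" "j < i" for i j
        using context_facts that by (rule sem_separated)
    qed (rule le)
    then obtain v where v: "layered n v a" by blast
    have "F w = F v" using Fw layered_schubert[OF v fam] by simp
    then have "w = v"
      using descent_family_inj[OF fam assms(2) layered_permutes[OF v]] by blast
    with layered_avoiding[OF v] show "avoiding n w" by simp
  qed
  then show ?thesis by (simp only: avoiding_iff)
qed

end
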